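(* The permutations $25134$ and $23514$ form an annihilator pair: for every permutation $\tau$ and every pair of distinct indices $i,j\le|\tau|$, the permutation $\tau_{i,j}[25134,23514]$ satisfies $\mu[1,\tau_{i,j}[25134,23514]]=0$.
   Context: Permutations are ordered by containment: $\sigma\le\pi$ if $\pi$ has a subsequence order-isomorphic to $\sigma$. The Möbius function: $\mu[\sigma,\pi]=0$ if $\sigma\not\le\pi$, $\mu[\sigma,\pi]=1$ if $\sigma=\pi$, and $\mu[\sigma,\pi]=-\sum_{\sigma\le\tau<\pi}\mu[\sigma,\tau]$ otherwise; $1$ is the permutation of length one. For a permutation $\tau$ of length $m$, distinct indices $i,j\le m$ and non-empty permutations $\phi,\psi$, the inflation $\tau_{i,j}[\phi,\psi]$ is the permutation obtained from $\tau$ by replacing the entry $\tau_i$ by a block of $|\phi|$ consecutive positions whose values form a set of consecutive integers and are order-isomorphic to $\phi$, replacing $\tau_j$ likewise by a block order-isomorphic to $\psi$, and keeping every other entry as a single entry, so that the relative order between different blocks/entries is that of the corresponding entries of $\tau$. *)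

theory Defs
  imports Complex_Main "HOL-Library.Sublist"
begin

text \<open>
  A permutation of length \<open>n\<close> is given in one-line notation, as a list containing each of
  \<open>1, ..., n\<close> exactly once.  Values start at 1 as usual, but positions are list
  indices and start at 0.
\<close>

definition is_perm :: "nat list \<Rightarrow> bool" where
  "is_perm xs \<longleftrightarrow> distinct xs \<and> set xs = {1..length xs}"

definition order_isomorphic :: "nat list \<Rightarrow> nat list \<Rightarrow> bool" where
  "order_isomorphic xs ys \<longleftrightarrow> length xs = length ys \<and>
     (\<forall>i<length xs. \<forall>j<length xs. xs ! i < xs ! j \<longleftrightarrow> ys ! i < ys ! j)"

definition contained :: "nat list \<Rightarrow> nat list \<Rightarrow> bool" (infix "\<preceq>" 50) where
  "\<sigma> \<preceq> \<pi> \<longleftrightarrow> (\<exists>zs. subseq zs \<pi> \<and> order_isomorphic zs \<sigma>)"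

lemma is_perm_nth_eq_card:
  assumes "is_perm xs" "i < length xs"
  shows "xs ! i = card {j. j < length xs \<and> \<not> xs ! i < xs ! j}"
proof -
  let ?J = "{j. j < length xs \<and> \<not> xs ! i < xs ! j}"
  have d: "distinct xs" and s: "set xs = {1..length xs}"
    using assms(1) by (auto simp: is_perm_def)
  have "xs ! i \<in> {1..length xs}" using assms(2) s nth_mem by blast
  have "(!) xs ` ?J = {1..xs ! i}"
  proof (intro equalityI subsetI)
    fix v assume "v \<in> (!) xs ` ?J"
    then obtain j where "j < length xs" "\<not> xs ! i < xs ! j" "v = xs ! j" by auto
    moreover from this have "xs ! j \<in> {1..length xs}" using s nth_mem by blast
    ultimately show "v \<in> {1..xs ! i}" by auto
  next
    fix v assume "v \<in> {1..xs ! i}"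
    with \<open>xs ! i \<in> {1..length xs}\<close> have "v \<in> set xs" and "v \<le> xs ! i" by (auto simp: s)
    then obtain j where "j < length xs" "xs ! j = v" by (auto simp: in_set_conv_nth)
    with \<open>v \<le> xs ! i\<close> show "v \<in> (!) xs ` ?J" by auto
  qed
  moreover have "inj_on ((!) xs) ?J" using d by (auto simp: inj_on_def nth_eq_iff_index_eq)
  ultimately show ?thesis by (metis card_atLeastAtMost card_image diff_Suc_1)
qed

lemma order_isomorphic_perm_eq:
  assumes "is_perm xs" "is_perm ys" "order_isomorphic xs ys"
  shows "xs = ys"
proof (rule nth_equalityI)
  show l: "length xs = length ys" using assms(3) by (simp add: order_isomorphic_def)
  fix i assume i: "i < length xs"
  have "{j. j < length xs \<and> \<not> xs ! i < xs ! j} = {j. j < length ys \<and> \<not> ys ! i < ys ! j}"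
    using assms(3) i by (auto simp: order_isomorphic_def)
  then show "xs ! i = ys ! i"
    using is_perm_nth_eq_card[OF assms(1) i] is_perm_nth_eq_card[OF assms(2)] i l by metis
qed

lemma contained_length: "\<sigma> \<preceq> \<pi> \<Longrightarrow> length \<sigma> \<le> length \<pi>"
  by (auto simp: contained_def order_isomorphic_def dest: list_emb_length)

lemma contained_neq_length:
  assumes "is_perm \<sigma>" "is_perm \<pi>" "\<sigma> \<preceq> \<pi>" "\<sigma> \<noteq> \<pi>"
  shows "length \<sigma> < length \<pi>"
proof (rule ccontr)
  assume "\<not> length \<sigma> < length \<pi>"
  with assms(3) have l: "length \<sigma> = length \<pi>" using contained_length by fastforce
  from assms(3) obtain zs where "subseq zs \<pi>" "order_isomorphic zs \<sigma>"
    by (auto simp: contained_def)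
  moreover from this l have "zs = \<pi>"
    by (metis order_isomorphic_def subseq_same_length)
  ultimately show False using assms order_isomorphic_perm_eq by metis
qed

text \<open>The index set of the sum in the Moebius recursion is always finite.\<close>

lemma finite_interval: "finite {\<tau>. is_perm \<tau> \<and> \<sigma> \<preceq> \<tau> \<and> \<tau> \<preceq> \<pi> \<and> \<tau> \<noteq> \<pi>}"
proof (rule finite_subset)
  show "finite {xs. set xs \<subseteq> {1..length \<pi>} \<and> length xs \<le> length \<pi>}"
    by (rule finite_lists_length_le) simp
  show "{\<tau>. is_perm \<tau> \<and> \<sigma> \<preceq> \<tau> \<and> \<tau> \<preceq> \<pi> \<and> \<tau> \<noteq> \<pi>}
      \<subseteq> {xs. set xs \<subseteq> {1..length \<pi>} \<and> length xs \<le> length \<pi>}"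
    by (auto simp: is_perm_def dest!: contained_length)
qed

text \<open>
  Lists that are not permutations get the junk value 0, which makes the recursion total.
\<close>

function mobius :: "nat list \<Rightarrow> nat list \<Rightarrow> int" where
  "mobius \<sigma> \<pi> =
     (if \<not> (is_perm \<sigma> \<and> is_perm \<pi> \<and> \<sigma> \<preceq> \<pi>) then 0
      else if \<sigma> = \<pi> then 1
      else - (\<Sum>\<tau> \<in> {\<tau>. is_perm \<tau> \<and> \<sigma> \<preceq> \<tau> \<and> \<tau> \<preceq> \<pi> \<and> \<tau> \<noteq> \<pi>}. mobius \<sigma> \<tau>))"
  by pat_completeness auto
termination
  by (relation "measure (\<lambda>(\<sigma>, \<pi>). length \<pi>)") (auto intro: contained_neq_length)

declare mobius.simps [simp del]

text \<open>
  In the inflation, the entry at position \<open>k\<close> of \<open>\<tau>\<close> becomes a copy of the permutation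
  \<open>inflation_block i j \<phi> \<psi> k\<close> whose values are shifted up by the total length of all blocks
  that replace smaller entries of \<open>\<tau>\<close>.
\<close>

definition inflation_block :: "nat \<Rightarrow> nat \<Rightarrow> nat list \<Rightarrow> nat list \<Rightarrow> nat \<Rightarrow> nat list" where
  "inflation_block i j \<phi> \<psi> k = (if k = i then \<phi> else if k = j then \<psi> else [1])"

definition inflation_offset ::
  "nat list \<Rightarrow> nat \<Rightarrow> nat \<Rightarrow> nat list \<Rightarrow> nat list \<Rightarrow> nat \<Rightarrow> nat" where
  "inflation_offset \<tau> i j \<phi> \<psi> k =
     (\<Sum>l | l < length \<tau> \<and> \<tau> ! l < \<tau> ! k. length (inflation_block i j \<phi> \<psi> l))"

definition inflation :: "nat list \<Rightarrow> nat \<Rightarrow> nat \<Rightarrow> nat list \<Rightarrow> nat list \<Rightarrow> nat list" where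
  "inflation \<tau> i j \<phi> \<psi> =
     concat (map (\<lambda>k. map (\<lambda>v. v + inflation_offset \<tau> i j \<phi> \<psi> k) (inflation_block i j \<phi> \<psi> k))
       [0..<length \<tau>])"

text \<open>
  An inflation of a permutation is a permutation, so the junk value of \<open>mobius\<close> never applies to it.
\<close>

lemma inflation_offset_less:
  assumes "k < length \<tau>" "\<tau> ! k < \<tau> ! l"
  shows "inflation_offset \<tau> i j \<phi> \<psi> k + length (inflation_block i j \<phi> \<psi> k)
    \<le> inflation_offset \<tau> i j \<phi> \<psi> l"
proof -
  let ?f = "\<lambda>l. length (inflation_block i j \<phi> \<psi> l)"
  let ?A = "{l. l < length \<tau> \<and> \<tau> ! l < \<tau> ! k}"
  have "sum ?f ?A + ?f k = sum ?f (insert k ?A)" by simp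
  also have "\<dots> \<le> sum ?f {m. m < length \<tau> \<and> \<tau> ! m < \<tau> ! l}"
    using assms by (intro sum_mono2) auto
  finally show ?thesis by (simp add: inflation_offset_def)
qed

lemma inflation_offset_bound:
  assumes "k < length \<tau>"
  shows "inflation_offset \<tau> i j \<phi> \<psi> k + length (inflation_block i j \<phi> \<psi> k)
    \<le> (\<Sum>l<length \<tau>. length (inflation_block i j \<phi> \<psi> l))"
proof -
  let ?f = "\<lambda>l. length (inflation_block i j \<phi> \<psi> l)"
  let ?A = "{l. l < length \<tau> \<and> \<tau> ! l < \<tau> ! k}"
  have "sum ?f ?A + ?f k = sum ?f (insert k ?A)" by simp
  also have "\<dots> \<le> sum ?f {..<length \<tau>}"
    using assms by (intro sum_mono2) auto
  finally show ?thesis by (simp add: inflation_offset_def)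
qed

lemma length_inflation:
  "length (inflation \<tau> i j \<phi> \<psi>) = (\<Sum>l<length \<tau>. length (inflation_block i j \<phi> \<psi> l))"
  by (simp add: inflation_def length_concat comp_def interv_sum_list_conv_sum_set_nat
      atLeast0LessThan)

lemma is_perm_inflation:
  assumes "is_perm \<tau>" "is_perm \<phi>" "is_perm \<psi>"
  shows "is_perm (inflation \<tau> i j \<phi> \<psi>)"
proof -
  let ?b = "inflation_block i j \<phi> \<psi>" and ?o = "inflation_offset \<tau> i j \<phi> \<psi>"
  let ?g = "\<lambda>k. map (\<lambda>v. v + ?o k) (?b k)"
  have b: "is_perm (?b k)" for k
    using assms by (auto simp: inflation_block_def is_perm_def)
  have g: "?o k < v \<and> v \<le> ?o k + length (?b k)" if "v \<in> set (?g k)" for k v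
    using b[of k] that by (auto simp: is_perm_def)
  have disj: "set (?g k) \<inter> set (?g l) = {}"
    if "k < length \<tau>" "l < length \<tau>" "k \<noteq> l" for k l
  proof -
    have "\<tau> ! k \<noteq> \<tau> ! l" using assms(1) that by (auto simp: is_perm_def nth_eq_iff_index_eq)
    then consider "\<tau> ! k < \<tau> ! l" | "\<tau> ! l < \<tau> ! k" by linarith
    then have "?o k + length (?b k) \<le> ?o l \<or> ?o l + length (?b l) \<le> ?o k"
      using inflation_offset_less that by cases blast+
    then show ?thesis using g by (meson disjoint_iff order.trans linorder_not_less)
  qed
  have dist: "distinct (?g k)" for k
    using b[of k] by (auto simp: is_perm_def distinct_map inj_on_def)
  have "distinct (concat (map ?g ks))"
    if "distinct ks" "set ks \<subseteq> {..<length \<tau>}" for ks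
    using that
  proof (induction ks)
    case (Cons k ks)
    have "set (?g k) \<inter> set (?g l) = {}" if "l \<in> set ks" for l
      using Cons.prems that by (intro disj) auto
    then have "set (?g k) \<inter> set (concat (map ?g ks)) = {}" by fastforce
    then show ?case using Cons dist[of k] by simp
  qed simp
  then have d: "distinct (inflation \<tau> i j \<phi> \<psi>)"
    unfolding inflation_def by (simp add: atLeast0LessThan)
  have "set (inflation \<tau> i j \<phi> \<psi>) \<subseteq> {1..length (inflation \<tau> i j \<phi> \<psi>)}"
  proof
    fix v assume "v \<in> set (inflation \<tau> i j \<phi> \<psi>)"
    then obtain k where k: "k < length \<tau>" "v \<in> set (?g k)"
      unfolding inflation_def set_concat set_map set_upt by auto
    then show "v \<in> {1..length (inflation \<tau> i j \<phi> \<psi>)}"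
      using g[OF k(2)] inflation_offset_bound[OF k(1), of i j \<phi> \<psi>]
      by (simp add: length_inflation)
  qed
  then have "set (inflation \<tau> i j \<phi> \<psi>) = {1..length (inflation \<tau> i j \<phi> \<psi>)}"
    by (rule card_subset_eq[rotated]) (simp_all add: distinct_card[OF d])
  with d show ?thesis by (simp add: is_perm_def)
qed

definition annihilator_pair :: "nat list \<Rightarrow> nat list \<Rightarrow> bool" where
  "annihilator_pair \<phi> \<psi> \<longleftrightarrow>
     is_perm \<phi> \<and> \<phi> \<noteq> [] \<and> is_perm \<psi> \<and> \<psi> \<noteq> [] \<and>
     (\<forall>\<tau> i j. is_perm \<tau> \<longrightarrow> i < length \<tau> \<longrightarrow> j < length \<tau> \<longrightarrow> i \<noteq> j \<longrightarrow>
        mobius [1] (inflation \<tau> i j \<phi> \<psi>) = 0)"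

end

theory Submission
  imports Defs
begin

text \<open>
  For a finite family of subsets \<open>S t\<close> of \<open>\<pi>\<close>, each with at least two points, and integers
  \<open>c t\<close>, put \<open>F \<rho> = \<Sum>t. c t\<close> over those \<open>t\<close> for which \<open>\<rho>\<close> embeds into \<open>S t\<close>.  Every
  principal ideal has Moebius sum 0, so \<open>\<Sum>\<rho>\<le>\<pi>. \<mu>[1,\<rho>] * F \<rho> = 0\<close>.  If \<open>F \<rho>\<close> or \<open>\<mu>[1,\<rho>]\<close> vanishes for each
  \<open>\<rho> < \<pi>\<close> while \<open>F \<pi> \<noteq> 0\<close>, then \<open>\<mu>[1,\<pi>] = 0\<close>.

  Deleting the middle point of an interval \<open>\<alpha> \<oplus> 1 \<oplus> \<beta>\<close> gives by induction that any permutation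
  with such an interval has \<open>\<mu> = 0\<close>.  For two disjoint intervals \<open>\<phi>\<close> and \<open>\<psi>\<close> we take
  coefficients of product form \<open>g \<alpha> * h \<beta>\<close> on the inflations by \<open>\<alpha> \<preceq> \<phi>\<close> and \<open>\<beta> \<preceq> \<psi>\<close>.
  The pair \<open>12, 21\<close> is handled by \<open>12 - 1\<close> and \<open>21 - 1\<close>.  For the main result
  the pairs in \<open>{25134, 1423} \<times> {23514, 2314}\<close> are treated simultaneously: apart from
  \<open>25134\<close> and \<open>1423\<close>, each pattern of \<open>25134\<close> is below \<open>2413\<close> or has an interval
  \<open>\<alpha> \<oplus> 1 \<oplus> \<beta>\<close>, so \<open>25134 - 2413\<close> works, and for \<open>1423\<close> one takes
  \<open>1423 - 312 - 132 + 12 + 21 - 1\<close>, where \<open>312\<close> and \<open>132\<close> cannot both occur as intervals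
  because they contain opposite adjacencies.
\<close>

section \<open>Order-isomorphic point sets and intervals\<close>

text \<open>Permutations are handled through the points of their plots, so that patterns and
  intervals are plain subsets: deleting, intersecting and exchanging points needs no reindexing of
  lists.\<close>

definition pts :: "nat list \<Rightarrow> (nat \<times> nat) set" where
  "pts xs = (\<lambda>k. (k, xs ! k)) ` {..<length xs}"

definition same_order :: "nat \<times> nat \<Rightarrow> nat \<times> nat \<Rightarrow> nat \<times> nat \<Rightarrow> nat \<times> nat \<Rightarrow> bool" where
  "same_order p q p' q' \<longleftrightarrow>
     (fst p < fst q \<longleftrightarrow> fst p' < fst q') \<and> (snd p < snd q \<longleftrightarrow> snd p' < snd q')"

definition sim_map :: "(nat \<times> nat \<Rightarrow> nat \<times> nat) \<Rightarrow> (nat \<times> nat) set \<Rightarrow> (nat \<times> nat) set \<Rightarrow> bool" where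
  "sim_map f P Q \<longleftrightarrow> bij_betw f P Q \<and> (\<forall>p\<in>P. \<forall>q\<in>P. same_order p q (f p) (f q))"

definition sim :: "(nat \<times> nat) set \<Rightarrow> (nat \<times> nat) set \<Rightarrow> bool" where
  "sim P Q \<longleftrightarrow> (\<exists>f. sim_map f P Q)"

definition embeds :: "nat list \<Rightarrow> (nat \<times> nat) set \<Rightarrow> bool" where
  "embeds \<sigma> P \<longleftrightarrow> (\<exists>S\<subseteq>P. sim (pts \<sigma>) S)"

text \<open>The empty set, single points and \<open>P\<close> itself count as intervals, since an
  occurrence may meet a given interval in any such way.\<close>

definition interval :: "(nat \<times> nat) set \<Rightarrow> (nat \<times> nat) set \<Rightarrow> bool" where
  "interval I P \<longleftrightarrow> I \<subseteq> P \<and>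
     (\<forall>p\<in>P - I. \<forall>q\<in>I. \<forall>r\<in>I. same_order p q p r \<and> same_order q p r p)"

definition has_interval :: "nat list \<Rightarrow> nat list \<Rightarrow> bool" where
  "has_interval \<alpha> \<pi> \<longleftrightarrow> (\<exists>I. interval I (pts \<pi>) \<and> sim (pts \<alpha>) I)"

lemma sim_refl: "sim P P"
  unfolding sim_def sim_map_def same_order_def by (rule exI[of _ id]) auto

lemma sim_sym: assumes "sim P Q" shows "sim Q P"
proof -
  obtain f where f: "bij_betw f P Q" "\<And>p q. p \<in> P \<Longrightarrow> q \<in> P \<Longrightarrow> same_order p q (f p) (f q)"
    using assms by (auto simp: sim_def sim_map_def)
  let ?g = "inv_into P f"
  have g: "bij_betw ?g Q P" using f(1) by (rule bij_betw_inv_into)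
  have "same_order p q (?g p) (?g q)" if "p \<in> Q" "q \<in> Q" for p q
  proof -
    have "?g p \<in> P" "?g q \<in> P" using g that by (auto dest: bij_betwE)
    from f(2)[OF this] show ?thesis
      using bij_betw_inv_into_right[OF f(1)] that by (simp add: same_order_def)
  qed
  then show ?thesis using g by (auto simp: sim_def sim_map_def)
qed

lemma sim_trans: assumes "sim P Q" "sim Q R" shows "sim P R"
proof -
  obtain f g where f: "sim_map f P Q" and g: "sim_map g Q R"
    using assms by (auto simp: sim_def)
  have "bij_betw (g \<circ> f) P R" using f g by (auto simp: sim_map_def intro: bij_betw_trans)
  moreover have "f p \<in> Q" if "p \<in> P" for p
    using f that by (auto simp: sim_map_def dest: bij_betwE)
  ultimately have "sim_map (g \<circ> f) P R"
    using f g by (simp add: sim_map_def same_order_def)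
  then show ?thesis by (auto simp: sim_def)
qed

lemma sim_map_subset: "sim_map f P Q \<Longrightarrow> S \<subseteq> P \<Longrightarrow> sim_map f S (f ` S)"
  by (auto simp: sim_map_def bij_betw_def intro: inj_on_subset)

lemma sim_subset: assumes "sim P Q" "S \<subseteq> P" shows "\<exists>R\<subseteq>Q. sim S R"
proof -
  obtain f where f: "sim_map f P Q" using assms by (auto simp: sim_def)
  then have "f ` S \<subseteq> Q" using assms(2) by (auto simp: sim_map_def bij_betw_def)
  then show ?thesis using sim_map_subset[OF f assms(2)] by (auto simp: sim_def)
qed

lemma sim_card: "sim P Q \<Longrightarrow> card P = card Q"
  by (auto simp: sim_def sim_map_def intro: bij_betw_same_card)

lemma finite_pts [simp]: "finite (pts xs)"
  by (simp add: pts_def)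

lemma card_pts [simp]: "card (pts xs) = length xs"
  by (simp add: pts_def card_image inj_on_def)

lemma interval_image:
  assumes f: "sim_map f P Q" and I: "interval I P"
  shows "interval (f ` I) Q"
proof -
  have IP: "I \<subseteq> P" using I by (simp add: interval_def)
  have Q: "Q = f ` P" using f by (simp add: sim_map_def bij_betw_def)
  have so: "same_order p q (f p) (f q)" if "p \<in> P" "q \<in> P" for p q
    using f that by (simp add: sim_map_def)
  have "same_order (f p) (f q) (f p) (f r) \<and> same_order (f q) (f p) (f r) (f p)"
    if "p \<in> P" "p \<notin> I" "q \<in> I" "r \<in> I" for p q r
  proof -
    have "same_order p q p r \<and> same_order q p r p" "q \<in> P" "r \<in> P"
      using I that IP by (auto simp: interval_def)
    then show ?thesis
      using so[of p q] so[of q p] so[of p r] so[of r p] that by (simp add: same_order_def)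
  qed
  then show ?thesis using IP unfolding interval_def Q by blast
qed

lemma interval_restrict: "interval I P \<Longrightarrow> S \<subseteq> P \<Longrightarrow> interval (S \<inter> I) S"
  by (auto simp: interval_def)

lemma interval_trans: "interval K I \<Longrightarrow> interval I P \<Longrightarrow> interval K P"
  unfolding interval_def by blast

lemma has_interval_pattern:
  assumes "interval I P" "sim P (pts \<pi>)" "sim (pts \<alpha>) I"
  shows "has_interval \<alpha> \<pi>"
proof -
  obtain f where f: "sim_map f P (pts \<pi>)" using assms(2) by (auto simp: sim_def)
  then have "sim I (f ` I)"
    using sim_map_subset[OF f] assms(1) by (auto simp: sim_def interval_def)
  then show ?thesis using interval_image[OF f assms(1)] assms(3) sim_trans
    by (auto simp: has_interval_def)
qed

lemma has_interval_trans:
  assumes "has_interval \<alpha> \<beta>" "has_interval \<beta> \<pi>" shows "has_interval \<alpha> \<pi>"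
proof -
  obtain I J where I: "interval I (pts \<beta>)" "sim (pts \<alpha>) I"
    and J: "interval J (pts \<pi>)" "sim (pts \<beta>) J"
    using assms by (auto simp: has_interval_def)
  obtain f where f: "sim_map f (pts \<beta>) J" using J(2) by (auto simp: sim_def)
  have "interval (f ` I) (pts \<pi>)" using interval_image[OF f I(1)] J(1) by (rule interval_trans)
  moreover have "sim I (f ` I)"
    using sim_map_subset[OF f] I(1) by (auto simp: sim_def interval_def)
  ultimately show ?thesis using I(2) sim_trans by (auto simp: has_interval_def)
qed

text \<open>A point outside an interval compares alike with all points inside it. So the part of
  \<open>S\<close> inside \<open>I\<close> can be exchanged for any similar subset of
  \<open>I\<close>, by the given map inside \<open>I\<close> and the identity elsewhere.\<close>

lemma sim_replace:
  assumes I: "interval I P" and S: "S \<subseteq> P" and A: "A \<subseteq> I" and sim: "sim (S \<inter> I) A"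
  shows "sim S (S - I \<union> A)"
proof -
  obtain f where f: "bij_betw f (S \<inter> I) A"
    "\<And>p q. p \<in> S \<inter> I \<Longrightarrow> q \<in> S \<inter> I \<Longrightarrow> same_order p q (f p) (f q)"
    using sim by (auto simp: sim_def sim_map_def)
  define g where "g p = (if p \<in> I then f p else p)" for p
  have "bij_betw g (S \<inter> I) A" using f(1) by (rule bij_betw_cong[THEN iffD1, rotated]) (simp add: g_def)
  moreover have "bij_betw g (S - I) (S - I)"
    by (rule bij_betw_cong[THEN iffD1, of _ id]) (auto simp: g_def)
  moreover have "(S - I) \<inter> A = {}" using A by auto
  ultimately have "bij_betw g ((S - I) \<union> (S \<inter> I)) (S - I \<union> A)"
    by (intro bij_betw_combine)
  moreover have "(S - I) \<union> (S \<inter> I) = S" by auto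
  ultimately have bij: "bij_betw g S (S - I \<union> A)" by simp
  have fA: "f p \<in> I" if "p \<in> S" "p \<in> I" for p using f(1) A that by (auto dest: bij_betwE)
  have out: "same_order p q p r \<and> same_order q p r p"
    if "p \<in> S" "p \<notin> I" "q \<in> I" "r \<in> I" for p q r
    using I S that unfolding interval_def by blast
  have "same_order p q (g p) (g q)" if "p \<in> S" "q \<in> S" for p q
    using f(2)[of p q] out[of p q "f q"] out[of q p "f p"] fA that
    by (auto simp: g_def same_order_def)
  then show ?thesis using bij by (auto simp: sim_def sim_map_def)
qed

section \<open>Containment and standardization\<close>

lemma subseq_index_map:
  "subseq xs ys \<Longrightarrow> \<exists>f. (\<forall>i<length xs. f i < length ys \<and> xs ! i = ys ! f i) \<and>
     (\<forall>i<length xs. \<forall>j<length xs. i < j \<longleftrightarrow> f i < f j)"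
proof (induction rule: list_emb.induct)
  case (list_emb_Cons xs ys y)
  then obtain f where "\<forall>i<length xs. f i < length ys \<and> xs ! i = ys ! f i"
    "\<forall>i<length xs. \<forall>j<length xs. i < j \<longleftrightarrow> f i < f j" by blast
  then show ?case by (intro exI[of _ "Suc \<circ> f"]) auto
next
  case (list_emb_Cons2 x y xs ys)
  then obtain f where "\<forall>i<length xs. f i < length ys \<and> xs ! i = ys ! f i"
    "\<forall>i<length xs. \<forall>j<length xs. i < j \<longleftrightarrow> f i < f j" by blast
  then show ?case using list_emb_Cons2.hyps
    by (intro exI[of _ "case_nat 0 (Suc \<circ> f)"]) (auto split: nat.split simp: nth_Cons)
qed auto

lemma subseq_map_nth:
  assumes "sorted_wrt (<) ks" "set ks \<subseteq> {..<length xs}"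
  shows "subseq (map ((!) xs) ks) xs"
proof -
  \<comment> \<open>A strictly increasing list is determined by its set, so \<open>ks\<close> is a
    filtered list of all indices.\<close>
  have "ks = filter (\<lambda>k. k \<in> set ks) [0..<length xs]"
    using assms by (intro sorted_distinct_set_unique)
      (auto simp: strict_sorted_iff sorted_filter[of id, simplified])
  then have "subseq ks [0..<length xs]" by (metis subseq_filter_left)
  then have "subseq (map ((!) xs) ks) (map ((!) xs) [0..<length xs])" by (rule subseq_map)
  then show ?thesis by (simp add: map_nth)
qed

lemma order_isomorphic_sim: "order_isomorphic xs ys \<Longrightarrow> sim (pts xs) (pts ys)"
proof -
  assume o: "order_isomorphic xs ys"
  let ?f = "\<lambda>p. (fst p, ys ! fst p)"
  have "bij_betw ?f (pts xs) (pts ys)"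
    using o by (auto simp: bij_betw_def inj_on_def pts_def order_isomorphic_def image_image)
  then have "sim_map ?f (pts xs) (pts ys)"
    using o by (auto simp: sim_map_def same_order_def pts_def order_isomorphic_def)
  then show ?thesis by (auto simp: sim_def)
qed

lemma sim_sublist:
  assumes "\<And>i. i < length zs \<Longrightarrow> f i < length ys \<and> zs ! i = ys ! f i"
    and "\<And>i j. i < length zs \<Longrightarrow> j < length zs \<Longrightarrow> i < j \<longleftrightarrow> f i < f j"
  shows "sim (pts zs) ((\<lambda>i. (f i, ys ! f i)) ` {..<length zs})"
proof -
  let ?g = "\<lambda>p. (f (fst p), ys ! f (fst p))"
  have "inj_on f {..<length zs}" using assms(2)
    by (metis (no_types, lifting) inj_onI lessThan_iff linorder_neq_iff)
  then have "bij_betw ?g (pts zs) ((\<lambda>i. (f i, ys ! f i)) ` {..<length zs})"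
    by (auto simp: bij_betw_def pts_def inj_on_def image_image)
  then have "sim_map ?g (pts zs) ((\<lambda>i. (f i, ys ! f i)) ` {..<length zs})"
    using assms by (auto simp: sim_map_def same_order_def pts_def)
  then show ?thesis by (auto simp: sim_def)
qed

text \<open>Forward, the indices of a subsequence give the points. Backward, the images of the
  points of \<sigma>, taken from left to right, have increasing positions and so form a
  subsequence.\<close>

lemma contained_iff_embeds: "\<sigma> \<preceq> \<pi> \<longleftrightarrow> embeds \<sigma> (pts \<pi>)"
proof
  assume "\<sigma> \<preceq> \<pi>"
  then obtain zs where zs: "subseq zs \<pi>" "order_isomorphic zs \<sigma>" by (auto simp: contained_def)
  obtain f where f: "\<And>i. i < length zs \<Longrightarrow> f i < length \<pi> \<and> zs ! i = \<pi> ! f i"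
    "\<And>i j. i < length zs \<Longrightarrow> j < length zs \<Longrightarrow> i < j \<longleftrightarrow> f i < f j"
    using subseq_index_map[OF zs(1)] by blast
  have "(\<lambda>i. (f i, \<pi> ! f i)) ` {..<length zs} \<subseteq> pts \<pi>" using f(1) by (auto simp: pts_def)
  moreover have "sim (pts \<sigma>) ((\<lambda>i. (f i, \<pi> ! f i)) ` {..<length zs})"
    using sim_sublist[OF f] order_isomorphic_sim[OF zs(2)] sim_sym sim_trans by blast
  ultimately show "embeds \<sigma> (pts \<pi>)" by (auto simp: embeds_def)
next
  assume "embeds \<sigma> (pts \<pi>)"
  then obtain S F where S: "S \<subseteq> pts \<pi>" and F: "sim_map F (pts \<sigma>) S"
    by (auto simp: embeds_def sim_def)
  define ks where "ks = map (\<lambda>i. fst (F (i, \<sigma> ! i))) [0..<length \<sigma>]"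
  have "F (i, \<sigma> ! i) \<in> pts \<pi>" if "i < length \<sigma>" for i
    using F S that by (auto simp: sim_map_def pts_def dest!: bij_betwE)
  then have k: "fst (F (i, \<sigma> ! i)) < length \<pi>" "snd (F (i, \<sigma> ! i)) = \<pi> ! fst (F (i, \<sigma> ! i))"
    if "i < length \<sigma>" for i using that by (fastforce simp: pts_def)+
  have so: "same_order (i, \<sigma> ! i) (j, \<sigma> ! j) (F (i, \<sigma> ! i)) (F (j, \<sigma> ! j))"
    if "i < length \<sigma>" "j < length \<sigma>" for i j
    using F that by (auto simp: sim_map_def pts_def)
  have "sorted_wrt (<) ks"
    unfolding sorted_wrt_iff_nth_less
  proof (intro allI impI)
    fix i j assume "i < j" "j < length ks"
    then show "ks ! i < ks ! j" using so[of i j] by (simp add: ks_def same_order_def)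
  qed
  moreover have "set ks \<subseteq> {..<length \<pi>}" using k(1) by (auto simp: ks_def)
  ultimately have "subseq (map ((!) \<pi>) ks) \<pi>" by (rule subseq_map_nth)
  moreover have "order_isomorphic (map ((!) \<pi>) ks) \<sigma>"
    using so k(2) by (simp add: order_isomorphic_def ks_def same_order_def)
  ultimately show "\<sigma> \<preceq> \<pi>" by (auto simp: contained_def)
qed

lemma sim_pts_eq:
  assumes "is_perm \<alpha>" "is_perm \<beta>" "sim (pts \<alpha>) (pts \<beta>)"
  shows "\<alpha> = \<beta>"
proof (rule ccontr)
  assume "\<alpha> \<noteq> \<beta>"
  moreover have "\<alpha> \<preceq> \<beta>" using assms(3) by (auto simp: contained_iff_embeds embeds_def)
  ultimately have "length \<alpha> < length \<beta>" using contained_neq_length assms by blast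
  then show False using sim_card[OF assms(3)] by simp
qed

text \<open>For distinct entries this replaces each by its rank, counted from 1. It is executable,
  so the patterns of a concrete list can be computed.\<close>

definition standardize :: "nat list \<Rightarrow> nat list" where
  "standardize zs = map (\<lambda>v. length (filter (\<lambda>w. w \<le> v) zs)) zs"

lemma standardize_less_iff:
  assumes "v \<in> set zs" "w \<in> set zs"
  shows "length (filter (\<lambda>u. u \<le> v) zs) < length (filter (\<lambda>u. u \<le> w) zs) \<longleftrightarrow> v < (w::nat)"
proof -
  have mono: "length (filter (\<lambda>u. u \<le> v) zs) \<le> length (filter (\<lambda>u. u \<le> w) zs)"
    if "v \<le> w" for v w :: nat
  proof -
    have "filter (\<lambda>u. u \<le> v) zs = filter (\<lambda>u. u \<le> v) (filter (\<lambda>u. u \<le> w) zs)"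
      using that by (auto intro!: filter_cong)
    then show ?thesis by (metis length_filter_le)
  qed
  have strict: "length (filter (\<lambda>u. u \<le> v) zs) < length (filter (\<lambda>u. u \<le> w) zs)" if "v < w"
  proof -
    have "filter (\<lambda>u. u \<le> v) zs = filter (\<lambda>u. u \<le> v) (filter (\<lambda>u. u \<le> w) zs)"
      using that by (auto intro!: filter_cong)
    moreover have "w \<in> set (filter (\<lambda>u. u \<le> w) zs)" using assms by simp
    ultimately show ?thesis using that length_filter_less
      by (metis linorder_not_le)
  qed
  show ?thesis using mono[of w v] strict by linarith
qed

lemma order_isomorphic_standardize: "order_isomorphic zs (standardize zs)"
  by (simp add: order_isomorphic_def standardize_def standardize_less_iff)

lemma is_perm_standardize:
  assumes "distinct zs" shows "is_perm (standardize zs)"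
proof -
  have "distinct (standardize zs)"
    unfolding standardize_def distinct_map using assms standardize_less_iff[of _ zs]
    by (metis (no_types, lifting) inj_onI less_irrefl linorder_neqE_nat)
  moreover have "set (standardize zs) = {1..length (standardize zs)}"
  proof (rule card_subset_eq)
    show "set (standardize zs) \<subseteq> {1..length (standardize zs)}"
    proof
      fix x assume "x \<in> set (standardize zs)"
      then obtain v where v: "v \<in> set zs" "x = length (filter (\<lambda>u. u \<le> v) zs)"
        by (auto simp: standardize_def)
      then have "v \<in> set (filter (\<lambda>u. u \<le> v) zs)" by simp
      then have "0 < length (filter (\<lambda>u. u \<le> v) zs)" by (rule length_pos_if_in_set)
      then show "x \<in> {1..length (standardize zs)}"
        using v(2) by (simp add: standardize_def Suc_le_eq del: length_greater_0_conv)
    qed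
  qed (simp_all add: distinct_card[OF calculation])
  ultimately show ?thesis by (simp add: is_perm_def)
qed

text \<open>Reading the values of \<open>S\<close> from left to right and standardizing them gives
  the permutation.\<close>

lemma pattern_exists:
  assumes "is_perm \<pi>" "S \<subseteq> pts \<pi>"
  shows "\<exists>\<alpha>. is_perm \<alpha> \<and> sim (pts \<alpha>) S"
proof -
  define ks where "ks = sorted_list_of_set (fst ` S)"
  define zs where "zs = map ((!) \<pi>) ks"
  have fin: "finite (fst ` S)" using assms(2) finite_subset by (meson finite_imageI finite_pts)
  have ks: "sorted_wrt (<) ks" "set ks = fst ` S" "distinct ks"
    using fin by (auto simp: ks_def)
  have sub: "set ks \<subseteq> {..<length \<pi>}" using assms(2) ks(2) by (auto simp: pts_def)
  have "sim (pts zs) ((\<lambda>i. (ks ! i, \<pi> ! (ks ! i))) ` {..<length zs})"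
  proof (rule sim_sublist)
    fix i j assume "i < length zs" "j < length zs"
    then show "i < j \<longleftrightarrow> ks ! i < ks ! j"
      using ks(1) by (metis length_map linorder_neqE_nat order_less_asym
        order_less_irrefl sorted_wrt_nth_less zs_def)
  next
    fix i assume "i < length zs"
    then show "ks ! i < length \<pi> \<and> zs ! i = \<pi> ! (ks ! i)"
      using sub by (auto simp: zs_def dest!: nth_mem)
  qed
  also have "(\<lambda>i. (ks ! i, \<pi> ! (ks ! i))) ` {..<length zs} = (\<lambda>k. (k, \<pi> ! k)) ` set ks"
    by (auto simp: zs_def set_conv_nth)
  also have "\<dots> = S" using assms(2) by (force simp: ks(2) pts_def)
  finally have "sim (pts zs) S" .
  then have "sim (pts (standardize zs)) S"
    using order_isomorphic_sim[OF order_isomorphic_standardize] sim_sym sim_trans by blast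
  moreover have "distinct zs"
    using assms(1) ks(3) sub inj_on_subset[OF inj_on_nth[of \<pi> "{..<length \<pi>}"] sub]
    by (simp add: zs_def is_perm_def distinct_map)
  ultimately show ?thesis using is_perm_standardize by blast
qed

text \<open>Containment can be tested on any occurrences of the two permutations; later both are
  subsets of the plot of a larger \<pi>.\<close>

lemma contained_sets:
  assumes "sim (pts \<alpha>) A" "sim (pts \<beta>) B"
  shows "\<alpha> \<preceq> \<beta> \<longleftrightarrow> (\<exists>S\<subseteq>B. sim A S)"
proof
  assume "\<alpha> \<preceq> \<beta>"
  then obtain S where S: "S \<subseteq> pts \<beta>" "sim (pts \<alpha>) S" by (auto simp: contained_iff_embeds embeds_def)
  obtain R where R: "R \<subseteq> B" "sim S R" using sim_subset[OF assms(2) S(1)] by auto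
  have "sim A R" by (rule sim_trans[OF sim_sym[OF assms(1)] sim_trans[OF S(2) R(2)]])
  then show "\<exists>S\<subseteq>B. sim A S" using R(1) by blast
next
  assume "\<exists>S\<subseteq>B. sim A S"
  then obtain S where S: "S \<subseteq> B" "sim A S" by auto
  obtain R where R: "R \<subseteq> pts \<beta>" "sim S R"
    using sim_subset[OF sim_sym[OF assms(2)] S(1)] by auto
  have "sim (pts \<alpha>) R" by (rule sim_trans[OF assms(1) sim_trans[OF S(2) R(2)]])
  then show "\<alpha> \<preceq> \<beta>" using R(1) unfolding contained_iff_embeds embeds_def by blast
qed

lemma embeds_contained:
  assumes "sim (pts \<beta>) B" shows "embeds \<alpha> B \<longleftrightarrow> \<alpha> \<preceq> \<beta>"
  using contained_sets[OF sim_refl assms] by (simp add: embeds_def)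

lemma contained_trans:
  assumes "\<alpha> \<preceq> \<beta>" "\<beta> \<preceq> \<gamma>" shows "\<alpha> \<preceq> \<gamma>"
proof -
  obtain S where S: "S \<subseteq> pts \<gamma>" "sim (pts \<beta>) S" 
    using assms(2) by (auto simp: contained_iff_embeds embeds_def)
  obtain R where "R \<subseteq> S" "sim (pts \<alpha>) R"
    using contained_sets[OF sim_refl S(2)] assms(1) by auto
  then show ?thesis using S(1) unfolding contained_iff_embeds embeds_def by blast
qed

lemma contained_refl: "\<alpha> \<preceq> \<alpha>"
  using sim_refl by (auto simp: contained_iff_embeds embeds_def)

section \<open>A vanishing criterion\<close>

lemma one_contained_iff: "[1] \<preceq> \<pi> \<longleftrightarrow> \<pi> \<noteq> []"
proof
  assume "[1] \<preceq> \<pi>" then show "\<pi> \<noteq> []" using contained_length by fastforce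
next
  assume "\<pi> \<noteq> []"
  then have "subseq [hd \<pi>] \<pi>" by (cases \<pi>) auto
  then show "[1] \<preceq> \<pi>" unfolding contained_def
    by (intro exI[of _ "[hd \<pi>]"]) (simp add: order_isomorphic_def)
qed

lemma finite_perms_contained: "finite {\<rho>. is_perm \<rho> \<and> \<rho> \<noteq> [] \<and> \<rho> \<preceq> \<pi>}"
proof (rule finite_subset)
  show "finite (insert \<pi> {\<tau>. is_perm \<tau> \<and> [1] \<preceq> \<tau> \<and> \<tau> \<preceq> \<pi> \<and> \<tau> \<noteq> \<pi>})"
    using finite_interval by blast
qed (use one_contained_iff in auto)

text \<open>The recursion for the top element cancels all other terms. The length bound excludes
  \<open>[1]\<close>, where the sum is 1.\<close>

lemma sum_mobius_ideal:
  assumes "is_perm \<pi>" "2 \<le> length \<pi>"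
  shows "(\<Sum>\<rho> | is_perm \<rho> \<and> \<rho> \<noteq> [] \<and> \<rho> \<preceq> \<pi>. mobius [1] \<rho>) = 0"
proof -
  let ?A = "{\<tau>. is_perm \<tau> \<and> [1] \<preceq> \<tau> \<and> \<tau> \<preceq> \<pi> \<and> \<tau> \<noteq> \<pi>}"
  have ne: "\<pi> \<noteq> []" "\<pi> \<noteq> [1]" using assms(2) by auto
  have "{\<rho>. is_perm \<rho> \<and> \<rho> \<noteq> [] \<and> \<rho> \<preceq> \<pi>} = insert \<pi> ?A"
    unfolding one_contained_iff using assms(1) ne contained_refl by blast
  moreover have "mobius [1] \<pi> = - (\<Sum>\<tau>\<in>?A. mobius [1] \<tau>)"
  proof -
    have "is_perm [1]" by (simp add: is_perm_def)
    then show ?thesis using assms(1) ne one_contained_iff[of \<pi>]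
      by (subst mobius.simps) simp
  qed
  ultimately show ?thesis using finite_interval[of "[1]" \<pi>] by simp
qed

lemma mobius_zero_criterion:
  fixes c :: "'t \<Rightarrow> int"
  assumes perm: "is_perm \<pi>" and fin: "finite T"
    and S: "\<And>t. t \<in> T \<Longrightarrow> S t \<subseteq> pts \<pi> \<and> 2 \<le> card (S t)"
    and below: "\<And>\<rho>. is_perm \<rho> \<Longrightarrow> \<rho> \<preceq> \<pi> \<Longrightarrow> length \<rho> < length \<pi> \<Longrightarrow>
      mobius [1] \<rho> \<noteq> 0 \<Longrightarrow> (\<Sum>t | t \<in> T \<and> embeds \<rho> (S t). c t) = 0"
    and top: "(\<Sum>t | t \<in> T \<and> embeds \<pi> (S t). c t) \<noteq> 0"
  shows "mobius [1] \<pi> = 0"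
proof (cases "\<pi> = []")
  case True
  \<comment> \<open>The empty permutation does not contain \<open>[1]\<close>, so the value is the
    default 0.\<close>
  then show ?thesis using one_contained_iff[of "[]"] by (subst mobius.simps) simp
next
  case False
  let ?L = "{\<rho>. is_perm \<rho> \<and> \<rho> \<noteq> [] \<and> \<rho> \<preceq> \<pi>}"
  have finL: "finite ?L" by (rule finite_perms_contained)
  \<comment> \<open>The patterns embedding into \<open>S t\<close> form the principal ideal below
    the pattern of \<open>S t\<close>, which has length at least 2.\<close>
  have ideal: "(\<Sum>\<rho>\<in>?L. if embeds \<rho> (S t) then mobius [1] \<rho> else 0) = 0" if t: "t \<in> T" for t
  proof -
    obtain \<sigma> where \<sigma>: "is_perm \<sigma>" "sim (pts \<sigma>) (S t)"
      using pattern_exists[OF perm conjunct1[OF S[OF t]]] by blast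
    have "\<sigma> \<preceq> \<pi>" using \<sigma>(2) S[OF t] by (auto simp: contained_iff_embeds embeds_def)
    then have "{\<rho> \<in> ?L. embeds \<rho> (S t)} = {\<rho>. is_perm \<rho> \<and> \<rho> \<noteq> [] \<and> \<rho> \<preceq> \<sigma>}"
      using embeds_contained[OF \<sigma>(2)] contained_trans by blast
    moreover have "2 \<le> length \<sigma>" using S[OF t] sim_card[OF \<sigma>(2)] by simp
    ultimately show ?thesis using sum_mobius_ideal[OF \<sigma>(1)]
      by (simp only: sum.inter_filter[OF finL, symmetric])
  qed
  have "0 = (\<Sum>t\<in>T. c t * (\<Sum>\<rho>\<in>?L. if embeds \<rho> (S t) then mobius [1] \<rho> else 0))"
    using ideal by simp
  also have "\<dots> = (\<Sum>\<rho>\<in>?L. \<Sum>t\<in>T. c t * (if embeds \<rho> (S t) then mobius [1] \<rho> else 0))"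
    by (simp add: sum_distrib_left) (rule sum.swap)
  also have "\<dots> = (\<Sum>\<rho>\<in>?L. mobius [1] \<rho> * (\<Sum>t | t \<in> T \<and> embeds \<rho> (S t). c t))"
  proof (rule sum.cong)
    fix \<rho>
    show "(\<Sum>t\<in>T. c t * (if embeds \<rho> (S t) then mobius [1] \<rho> else 0)) =
        mobius [1] \<rho> * (\<Sum>t | t \<in> T \<and> embeds \<rho> (S t). c t)"
      unfolding sum.inter_filter[OF fin] sum_distrib_left by (intro sum.cong) auto
  qed simp
  \<comment> \<open>By \<open>below\<close>, one of the two factors vanishes for every \<rho>
    shorter than \<pi>, so only the top term survives.\<close>
  also have "\<dots> = (\<Sum>\<rho>\<in>?L. if \<rho> = \<pi> then mobius [1] \<pi> * (\<Sum>t | t \<in> T \<and> embeds \<pi> (S t). c t) else 0)"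
  proof (intro sum.cong refl)
    fix \<rho> assume \<rho>: "\<rho> \<in> ?L"
    show "mobius [1] \<rho> * (\<Sum>t | t \<in> T \<and> embeds \<rho> (S t). c t) =
      (if \<rho> = \<pi> then mobius [1] \<pi> * (\<Sum>t | t \<in> T \<and> embeds \<pi> (S t). c t) else 0)"
      using below[of \<rho>] contained_neq_length[of \<rho> \<pi>] perm \<rho> by auto
  qed
  also have "\<dots> = mobius [1] \<pi> * (\<Sum>t | t \<in> T \<and> embeds \<pi> (S t). c t)"
    using finL perm False contained_refl by simp
  finally show ?thesis using top by simp
qed

section \<open>Intervals that are a sum around a point\<close>

definition below :: "nat \<times> nat \<Rightarrow> nat \<times> nat \<Rightarrow> bool" where
  "below p q \<longleftrightarrow> fst p < fst q \<and> snd p < snd q"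

text \<open>The interval \<open>I\<close> has the form \<alpha> \<oplus> 1 \<oplus> \<beta> with
  both outer summands non-empty, and \<open>x\<close> is the middle point.\<close>

definition sum_cut :: "(nat \<times> nat) set \<Rightarrow> bool" where
  "sum_cut P \<longleftrightarrow> (\<exists>I x. interval I P \<and> x \<in> I \<and> (\<forall>y\<in>I. y = x \<or> below y x \<or> below x y) \<and>
     (\<exists>a\<in>I. below a x) \<and> (\<exists>b\<in>I. below x b))"

lemma sum_cut_transfer:
  assumes "sum_cut P" "sim P J" "interval J Q"
  shows "sum_cut Q"
proof -
  obtain I x a b where I: "interval I P" "x \<in> I" "\<forall>y\<in>I. y = x \<or> below y x \<or> below x y"
    "a \<in> I" "below a x" "b \<in> I" "below x b"
    using assms(1) by (auto simp: sum_cut_def)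
  obtain f where f: "sim_map f P J" using assms(2) by (auto simp: sim_def)
  have "interval (f ` I) Q" using interval_image[OF f I(1)] assms(3) by (rule interval_trans)
  moreover have so: "below p q \<longleftrightarrow> below (f p) (f q)" if "p \<in> I" "q \<in> I" for p q
    using f I(1) that by (auto simp: sim_map_def interval_def same_order_def below_def)
  ultimately show ?thesis using I unfolding sum_cut_def
    by (intro exI[of _ "f ` I"] exI[of _ "f x"]) auto
qed

lemma embeds_proper:
  assumes "S \<subseteq> pts \<pi>" shows "embeds \<pi> S \<longleftrightarrow> S = pts \<pi>"
proof
  assume "embeds \<pi> S"
  then obtain R where R: "R \<subseteq> S" "sim (pts \<pi>) R" by (auto simp: embeds_def)
  then have "card R = card (pts \<pi>)" using sim_card by metis
  then have "R = pts \<pi>" using R(1) assms by (intro card_subset_eq) auto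
  then show "S = pts \<pi>" using R(1) assms by auto
next
  assume "S = pts \<pi>"
  then show "embeds \<pi> S" using sim_refl unfolding embeds_def by blast
qed

lemma sim_exchange:
  assumes "x \<in> A" "a \<notin> A" "\<And>y. y \<in> A \<Longrightarrow> y \<noteq> x \<Longrightarrow> same_order x y a y \<and> same_order y x y a"
  shows "sim A (insert a (A - {x}))"
proof -
  let ?f = "\<lambda>y. if y = x then a else y"
  have "bij_betw ?f A (insert a (A - {x}))"
    using assms(1,2) by (auto simp: bij_betw_def inj_on_def)
  moreover have "same_order p q (?f p) (?f q)" if "p \<in> A" "q \<in> A" for p q
    using assms(3) that by (auto simp: same_order_def)
  ultimately show ?thesis by (auto simp: sim_def sim_map_def)
qed

text \<open>The criterion is applied to the whole plot and the plot without \<open>x\<close>, with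
  coefficients 1 and -1. A shorter \<rho> either embeds without \<open>x\<close>, and the
  coefficients cancel, or every occurrence uses \<open>x\<close> with points of \<open>I\<close> on
  both sides; then \<rho> has a cut itself and vanishes by induction.\<close>

lemma mobius_sum_cut: "is_perm \<pi> \<Longrightarrow> sum_cut (pts \<pi>) \<Longrightarrow> mobius [1] \<pi> = 0"
proof (induction "length \<pi>" arbitrary: \<pi> rule: less_induct)
  case less
  let ?P = "pts \<pi>"
  obtain I x a b where I: "interval I ?P" and x: "x \<in> I"
    and cut: "\<forall>y\<in>I. y = x \<or> below y x \<or> below x y"
    and a: "a \<in> I" "below a x" and b: "b \<in> I" "below x b"
    using less.prems(2) by (auto simp: sum_cut_def)
  have IP: "I \<subseteq> ?P" using I by (simp add: interval_def)
  have neq: "?P \<noteq> ?P - {x}" using x IP by auto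
  have ab: "a \<noteq> x" "b \<noteq> x" "a \<noteq> b" using a b by (auto simp: below_def)
  have "{a, b} \<subseteq> ?P - {x}" using a b ab IP by auto
  then have "card {a, b} \<le> card (?P - {x})" by (intro card_mono) auto
  then have two: "2 \<le> card (?P - {x})" using ab by simp
  have two': "2 \<le> card ?P" by (rule order_trans[OF two]) (rule card_mono, auto)
  show ?case
  proof (rule mobius_zero_criterion[where T = "{?P, ?P - {x}}" and S = "\<lambda>t. t"
        and c = "\<lambda>t. if t = ?P then 1 else - 1"])
    show "(\<Sum>t | t \<in> {?P, ?P - {x}} \<and> embeds \<pi> t. if t = ?P then 1 else - 1) \<noteq> (0::int)"
    proof -
      have "{t. t \<in> {?P, ?P - {x}} \<and> embeds \<pi> t} = {?P}"
        using neq by (auto simp: embeds_proper)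
      then show ?thesis by simp
    qed
  next
    fix \<rho> assume \<rho>: "is_perm \<rho>" "\<rho> \<preceq> \<pi>" "length \<rho> < length \<pi>" "mobius [1] \<rho> \<noteq> 0"
    have "embeds \<rho> (?P - {x})"
    proof -
      obtain S where S: "S \<subseteq> ?P" "sim (pts \<rho>) S"
        using \<rho>(2) by (auto simp: contained_iff_embeds embeds_def)
      have move: "embeds \<rho> (?P - {x})"
        if "z \<in> I" "z \<noteq> x" "z \<notin> S" "x \<in> S"
          and so: "\<And>y. y \<in> S \<inter> I \<Longrightarrow> y \<noteq> x \<Longrightarrow> same_order x y z y \<and> same_order y x y z" for z
      proof -
        let ?A = "insert z (S \<inter> I - {x})"
        have "sim (S \<inter> I) ?A" using that x by (intro sim_exchange) auto
        then have "sim S (S - I \<union> ?A)" using that(1) by (intro sim_replace[OF I S(1)]) auto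
        then have "sim (pts \<rho>) (S - I \<union> ?A)" by (rule sim_trans[OF S(2)])
        moreover have "S - I \<union> ?A \<subseteq> ?P - {x}" using that(1,2) S(1) IP x by auto
        ultimately show ?thesis unfolding embeds_def by blast
      qed
      consider "x \<notin> S" | "x \<in> S" "\<forall>y\<in>S \<inter> I. \<not> below y x" | "x \<in> S" "\<forall>y\<in>S \<inter> I. \<not> below x y"
        | "x \<in> S" "\<exists>y\<in>S \<inter> I. below y x" "\<exists>y\<in>S \<inter> I. below x y" by blast
      then show ?thesis
      proof cases
        case 1
        then show ?thesis using S unfolding embeds_def by blast
      next
        case 2
        then have "below x y" if "y \<in> S \<inter> I" "y \<noteq> x" for y using cut that by auto
        then show ?thesis using 2 a ab
          by (intro move[of a]) (fastforce simp: same_order_def below_def)+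
      next
        case 3
        then have "below y x" if "y \<in> S \<inter> I" "y \<noteq> x" for y using cut that by auto
        then show ?thesis using 3 b ab
          by (intro move[of b]) (fastforce simp: same_order_def below_def)+
      next
        case 4
        have "sum_cut S" unfolding sum_cut_def
          using 4 x cut interval_restrict[OF I S(1)] by (intro exI[of _ "S \<inter> I"] exI[of _ x]) auto
        then have "sum_cut (pts \<rho>)"
          using sim_sym[OF S(2)] by (rule sum_cut_transfer) (simp add: interval_def)
        then show ?thesis using less.hyps \<rho> by blast
      qed
    qed
    moreover have "embeds \<rho> ?P" using \<rho>(2) by (simp add: contained_iff_embeds)
    ultimately have "{t. t \<in> {?P, ?P - {x}} \<and> embeds \<rho> t} = {?P, ?P - {x}}" by auto
    then show "(\<Sum>t | t \<in> {?P, ?P - {x}} \<and> embeds \<rho> t. if t = ?P then 1 else - 1) = (0::int)"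
      using neq by simp
  qed (use less.prems two two' in auto)
qed

lemma sim_nonempty: "sim P Q \<Longrightarrow> P \<noteq> {} \<longleftrightarrow> Q \<noteq> {}"
  by (auto simp: sim_def sim_map_def bij_betw_def)

section \<open>Two disjoint intervals\<close>

text \<open>
  The sum over \<open>G \<times> H\<close> factors row by row and column by column, so it suffices that
  all row sums or all column sums vanish.  The sets \<open>X\<close> and \<open>Y\<close> are the patterns that an
  embedding of \<open>\<rho>\<close> induces on \<open>I\<close> and \<open>J\<close>.
\<close>

lemma mobius_pair_criterion:
  fixes g h :: "nat list \<Rightarrow> int"
  assumes perm: "is_perm \<pi>" and I: "interval I (pts \<pi>)" and J: "interval J (pts \<pi>)"
    and disj: "I \<inter> J = {}"
    and \<phi>: "is_perm \<phi>" "sim (pts \<phi>) I" and \<psi>: "is_perm \<psi>" "sim (pts \<psi>) J"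
    and fin: "finite G" "finite H"
    and G: "\<And>\<alpha>. \<alpha> \<in> G \<Longrightarrow> is_perm \<alpha> \<and> \<alpha> \<noteq> [] \<and> \<alpha> \<preceq> \<phi>"
    and H: "\<And>\<beta>. \<beta> \<in> H \<Longrightarrow> is_perm \<beta> \<and> \<beta> \<noteq> [] \<and> \<beta> \<preceq> \<psi>"
    and lead: "\<phi> \<in> G" "\<psi> \<in> H" "g \<phi> \<noteq> 0" "h \<psi> \<noteq> 0"
    and below: "\<And>\<rho>. is_perm \<rho> \<Longrightarrow> length \<rho> < length \<pi> \<Longrightarrow> mobius [1] \<rho> \<noteq> 0 \<Longrightarrow>
      (\<forall>X. (\<forall>\<alpha>\<in>X. is_perm \<alpha> \<and> \<alpha> \<preceq> \<phi> \<and> has_interval \<alpha> \<rho>) \<longrightarrow>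
        (\<Sum>\<alpha> | \<alpha> \<in> G \<and> (\<exists>\<xi>\<in>X. \<xi> \<preceq> \<alpha>). g \<alpha>) = 0) \<or>
      (\<forall>Y. (\<forall>\<beta>\<in>Y. is_perm \<beta> \<and> \<beta> \<preceq> \<psi> \<and> has_interval \<beta> \<rho>) \<longrightarrow>
        (\<Sum>\<beta> | \<beta> \<in> H \<and> (\<exists>\<xi>\<in>Y. \<xi> \<preceq> \<beta>). h \<beta>) = 0)"
  shows "mobius [1] \<pi> = 0"
proof -
  let ?P = "pts \<pi>"
  have IP: "I \<subseteq> ?P" and JP: "J \<subseteq> ?P" using I J by (auto simp: interval_def)
  have "\<exists>A\<subseteq>I. sim (pts \<alpha>) A" if "\<alpha> \<in> G" for \<alpha>
    using contained_sets[OF sim_refl \<phi>(2)] G that by blast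
  then obtain A where A: "\<And>\<alpha>. \<alpha> \<in> G \<Longrightarrow> A \<alpha> \<subseteq> I \<and> sim (pts \<alpha>) (A \<alpha>)" by metis
  have "\<exists>B\<subseteq>J. sim (pts \<beta>) B" if "\<beta> \<in> H" for \<beta>
    using contained_sets[OF sim_refl \<psi>(2)] H that by blast
  then obtain B where B: "\<And>\<beta>. \<beta> \<in> H \<Longrightarrow> B \<beta> \<subseteq> J \<and> sim (pts \<beta>) (B \<beta>)" by metis
  \<comment> \<open>For \<open>t = (\<alpha>, \<beta>)\<close> this is the plot of \<pi> with its
    two blocks shrunk to copies of \<alpha> and \<beta>.\<close>
  define S where "S t = ?P - I - J \<union> A (fst t) \<union> B (snd t)" for t
  define c where "c t = g (fst t) * h (snd t)" for t
  \<comment> \<open>Non-empty copies inside the disjoint blocks supply the two points that the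
    criterion requires.\<close>
  have ne: "A \<alpha> \<noteq> {}" if "\<alpha> \<in> G" for \<alpha>
  proof -
    have "pts \<alpha> \<noteq> {}" using G[OF that] by (auto simp: pts_def)
    then show ?thesis using sim_nonempty A that by blast
  qed
  have neB: "B \<beta> \<noteq> {}" if "\<beta> \<in> H" for \<beta>
  proof -
    have "pts \<beta> \<noteq> {}" using H[OF that] by (auto simp: pts_def)
    then show ?thesis using sim_nonempty B that by blast
  qed
  show ?thesis
  proof (rule mobius_zero_criterion[where T = "G \<times> H" and S = S and c = c])
    fix t assume "t \<in> G \<times> H"
    then obtain \<alpha> \<beta> where t: "t = (\<alpha>, \<beta>)" "\<alpha> \<in> G" "\<beta> \<in> H" by auto
    then obtain p q where pq: "p \<in> A \<alpha>" "q \<in> B \<beta>" using ne neB by blast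
    have sub: "S t \<subseteq> ?P" using A[OF t(2)] B[OF t(3)] IP JP t(1) by (auto simp: S_def)
    have "p \<noteq> q" using pq A[OF t(2)] B[OF t(3)] disj by blast
    moreover have "{p, q} \<subseteq> S t" using pq t(1) by (auto simp: S_def)
    then have "card {p, q} \<le> card (S t)"
      using finite_subset[OF sub] by (intro card_mono) auto
    ultimately show "S t \<subseteq> ?P \<and> 2 \<le> card (S t)" using sub by simp
  next
    have "{t. t \<in> G \<times> H \<and> embeds \<pi> (S t)} = {(\<phi>, \<psi>)}"
    proof (intro equalityI subsetI)
      fix t assume "t \<in> {t. t \<in> G \<times> H \<and> embeds \<pi> (S t)}"
      then obtain \<alpha> \<beta> where t: "t = (\<alpha>, \<beta>)" "\<alpha> \<in> G" "\<beta> \<in> H" "embeds \<pi> (S t)" by auto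
      have "S t \<subseteq> ?P" using A[OF t(2)] B[OF t(3)] IP JP t(1) by (auto simp: S_def)
      then have "S t = ?P" using t(4) embeds_proper by blast
      moreover have "S t \<inter> I \<subseteq> A \<alpha>" "S t \<inter> J \<subseteq> B \<beta>"
        using A[OF t(2)] B[OF t(3)] t(1) disj by (auto simp: S_def)
      ultimately have "A \<alpha> = I" "B \<beta> = J" using A[OF t(2)] B[OF t(3)] IP JP by auto
      then have "sim (pts \<alpha>) (pts \<phi>)" "sim (pts \<beta>) (pts \<psi>)"
        using A[OF t(2)] B[OF t(3)] sim_trans[OF _ sim_sym[OF \<phi>(2)]]
          sim_trans[OF _ sim_sym[OF \<psi>(2)]] by auto
      then have "\<alpha> = \<phi>" "\<beta> = \<psi>" using sim_pts_eq G[OF t(2)] H[OF t(3)] \<phi>(1) \<psi>(1) by auto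
      then show "t \<in> {(\<phi>, \<psi>)}" using t(1) by simp
    next
      fix t assume "t \<in> {(\<phi>, \<psi>)}"
      then have t: "t = (\<phi>, \<psi>)" by simp
      have "finite I" "finite J" using IP JP finite_subset finite_pts by blast+
      moreover have "card (A \<phi>) = card I" "card (B \<psi>) = card J"
        using A[OF lead(1)] B[OF lead(2)] sim_card \<phi>(2) \<psi>(2) by metis+
      ultimately have "A \<phi> = I" "B \<psi> = J"
        using A[OF lead(1)] B[OF lead(2)] card_subset_eq by blast+
      then have "S t = ?P" using t IP JP by (auto simp: S_def)
      then show "t \<in> {t. t \<in> G \<times> H \<and> embeds \<pi> (S t)}"
        using t lead embeds_proper[of ?P] by simp
    qed
    then show "(\<Sum>t | t \<in> G \<times> H \<and> embeds \<pi> (S t). c t) \<noteq> 0" using lead by (simp add: c_def)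
  next
    fix \<rho> assume \<rho>: "is_perm \<rho>" "\<rho> \<preceq> \<pi>" "length \<rho> < length \<pi>" "mobius [1] \<rho> \<noteq> 0"
    \<comment> \<open>\<open>W\<close> records the pairs of patterns that the occurrences of \<rho>
      in \<pi> leave on \<open>I\<close> and \<open>J\<close>.\<close>
    define W where "W = {(\<alpha>, \<beta>). is_perm \<alpha> \<and> is_perm \<beta> \<and>
      (\<exists>R\<subseteq>?P. sim (pts \<rho>) R \<and> sim (pts \<alpha>) (R \<inter> I) \<and> sim (pts \<beta>) (R \<inter> J))}"
    have W: "is_perm \<alpha> \<and> \<alpha> \<preceq> \<phi> \<and> has_interval \<alpha> \<rho> \<and> is_perm \<beta> \<and> \<beta> \<preceq> \<psi> \<and> has_interval \<beta> \<rho>"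
      if w: "(\<alpha>, \<beta>) \<in> W" for \<alpha> \<beta>
    proof -
      obtain R where R: "R \<subseteq> ?P" "sim (pts \<rho>) R" "sim (pts \<alpha>) (R \<inter> I)" "sim (pts \<beta>) (R \<inter> J)"
        and p: "is_perm \<alpha>" "is_perm \<beta>" using w by (auto simp: W_def)
      have "\<alpha> \<preceq> \<phi>" using contained_sets[OF R(3) \<phi>(2)] sim_refl by blast
      moreover have "\<beta> \<preceq> \<psi>" using contained_sets[OF R(4) \<psi>(2)] sim_refl by blast
      moreover have "has_interval \<alpha> \<rho>"
        by (rule has_interval_pattern[OF interval_restrict[OF I R(1)] sim_sym[OF R(2)] R(3)])
      moreover have "has_interval \<beta> \<rho>"
        by (rule has_interval_pattern[OF interval_restrict[OF J R(1)] sim_sym[OF R(2)] R(4)])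
      ultimately show ?thesis using p by blast
    qed
    \<comment> \<open>Embeddability is decided by \<open>W\<close> alone: an occurrence can be moved
      inside \<open>I\<close> and then, independently, inside \<open>J\<close>, until it lies in the
      chosen copies.\<close>
    have emb: "embeds \<rho> (S (\<alpha>, \<beta>)) \<longleftrightarrow> (\<exists>(\<xi>, \<eta>)\<in>W. \<xi> \<preceq> \<alpha> \<and> \<eta> \<preceq> \<beta>)"
      if "\<alpha> \<in> G" "\<beta> \<in> H" for \<alpha> \<beta>
    proof
      note A' = A[OF that(1)] and B' = B[OF that(2)]
      assume "embeds \<rho> (S (\<alpha>, \<beta>))"
      then obtain R where R: "R \<subseteq> S (\<alpha>, \<beta>)" "sim (pts \<rho>) R" by (auto simp: embeds_def)
      have RI: "R \<inter> I \<subseteq> A \<alpha>" and RJ: "R \<inter> J \<subseteq> B \<beta>"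
        using R(1) A' B' disj unfolding S_def fst_conv snd_conv by blast+
      have RP: "R \<subseteq> ?P" using R(1) A' B' IP JP unfolding S_def fst_conv snd_conv by blast
      obtain \<xi> where \<xi>: "is_perm \<xi>" "sim (pts \<xi>) (R \<inter> I)"
        using pattern_exists[OF perm, of "R \<inter> I"] RP by blast
      obtain \<eta> where \<eta>: "is_perm \<eta>" "sim (pts \<eta>) (R \<inter> J)"
        using pattern_exists[OF perm, of "R \<inter> J"] RP by blast
      have "(\<xi>, \<eta>) \<in> W" using RP R(2) \<xi> \<eta> by (auto simp: W_def)
      moreover have "\<xi> \<preceq> \<alpha>" using contained_sets[OF \<xi>(2) conjunct2[OF A']] RI sim_refl by blast
      moreover have "\<eta> \<preceq> \<beta>" using contained_sets[OF \<eta>(2) conjunct2[OF B']] RJ sim_refl by blast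
      ultimately show "\<exists>(\<xi>, \<eta>)\<in>W. \<xi> \<preceq> \<alpha> \<and> \<eta> \<preceq> \<beta>" by blast
    next
      note A' = A[OF that(1)] and B' = B[OF that(2)]
      assume "\<exists>(\<xi>, \<eta>)\<in>W. \<xi> \<preceq> \<alpha> \<and> \<eta> \<preceq> \<beta>"
      then obtain \<xi> \<eta> R where R: "R \<subseteq> ?P" "sim (pts \<rho>) R" "sim (pts \<xi>) (R \<inter> I)"
        "sim (pts \<eta>) (R \<inter> J)" and le: "\<xi> \<preceq> \<alpha>" "\<eta> \<preceq> \<beta>" by (auto simp: W_def)
      obtain X where X: "X \<subseteq> A \<alpha>" "sim (R \<inter> I) X"
        using contained_sets[OF R(3) conjunct2[OF A']] le(1) by blast
      obtain Y where Y: "Y \<subseteq> B \<beta>" "sim (R \<inter> J) Y"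
        using contained_sets[OF R(4) conjunct2[OF B']] le(2) by blast
      let ?R = "R - I \<union> X"
      have s1: "sim R ?R" using X A' by (intro sim_replace[OF I R(1)]) auto
      have J': "?R \<inter> J = R \<inter> J" using X(1) A' disj by auto
      have RP: "?R \<subseteq> ?P" using R(1) X(1) A' IP by auto
      have s2: "sim ?R (?R - J \<union> Y)"
        using Y B' J' by (intro sim_replace[OF J RP]) auto
      have "sim (pts \<rho>) (?R - J \<union> Y)" by (rule sim_trans[OF R(2) sim_trans[OF s1 s2]])
      moreover have "?R - J \<union> Y \<subseteq> S (\<alpha>, \<beta>)" using R(1) X(1) Y(1) by (auto simp: S_def)
      ultimately show "embeds \<rho> (S (\<alpha>, \<beta>))" unfolding embeds_def by blast
    qed
    \<comment> \<open>For fixed \<beta>, \<open>X \<beta>\<close> keeps the patterns on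
      \<open>I\<close> whose partner on \<open>J\<close> fits below \<beta>. So \<rho> embeds into
      \<open>S (\<alpha>, \<beta>)\<close> exactly if some member of \<open>X \<beta>\<close> is
      below \<alpha>, and the row and column hypotheses apply.\<close>
    define X where "X \<beta> = {\<xi>. \<exists>\<eta>. (\<xi>, \<eta>) \<in> W \<and> \<eta> \<preceq> \<beta>}" for \<beta>
    define Y where "Y \<alpha> = {\<eta>. \<exists>\<xi>. (\<xi>, \<eta>) \<in> W \<and> \<xi> \<preceq> \<alpha>}" for \<alpha>
    have "(\<Sum>t | t \<in> G \<times> H \<and> embeds \<rho> (S t). c t) =
        (\<Sum>\<alpha>\<in>G. \<Sum>\<beta>\<in>H. if embeds \<rho> (S (\<alpha>, \<beta>)) then g \<alpha> * h \<beta> else 0)"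
      using fin by (simp add: sum.inter_filter sum.cartesian_product c_def case_prod_beta)
    also have "\<dots> = 0"
      using below[OF \<rho>(1,3,4)]
    proof
      assume *: "\<forall>X. (\<forall>\<alpha>\<in>X. is_perm \<alpha> \<and> \<alpha> \<preceq> \<phi> \<and> has_interval \<alpha> \<rho>) \<longrightarrow>
        (\<Sum>\<alpha> | \<alpha> \<in> G \<and> (\<exists>\<xi>\<in>X. \<xi> \<preceq> \<alpha>). g \<alpha>) = 0"
      have "(\<Sum>\<alpha>\<in>G. if embeds \<rho> (S (\<alpha>, \<beta>)) then g \<alpha> * h \<beta> else 0) = 0" if \<beta>: "\<beta> \<in> H" for \<beta>
      proof -
        have "(\<Sum>\<alpha>\<in>G. if embeds \<rho> (S (\<alpha>, \<beta>)) then g \<alpha> * h \<beta> else 0) =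
            (\<Sum>\<alpha>\<in>G. if \<exists>\<xi>\<in>X \<beta>. \<xi> \<preceq> \<alpha> then g \<alpha> else 0) * h \<beta>"
          unfolding sum_distrib_right using emb[OF _ \<beta>] by (intro sum.cong) (auto simp: X_def)
        moreover have "\<forall>\<alpha>\<in>X \<beta>. is_perm \<alpha> \<and> \<alpha> \<preceq> \<phi> \<and> has_interval \<alpha> \<rho>"
          using W by (auto simp: X_def)
        ultimately show ?thesis using * fin(1) by (simp add: sum.inter_filter)
      qed
      then show ?thesis by (subst sum.swap) simp
    next
      assume *: "\<forall>Y. (\<forall>\<beta>\<in>Y. is_perm \<beta> \<and> \<beta> \<preceq> \<psi> \<and> has_interval \<beta> \<rho>) \<longrightarrow>
        (\<Sum>\<beta> | \<beta> \<in> H \<and> (\<exists>\<xi>\<in>Y. \<xi> \<preceq> \<beta>). h \<beta>) = 0"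
      have "(\<Sum>\<beta>\<in>H. if embeds \<rho> (S (\<alpha>, \<beta>)) then g \<alpha> * h \<beta> else 0) = 0" if \<alpha>: "\<alpha> \<in> G" for \<alpha>
      proof -
        have "(\<Sum>\<beta>\<in>H. if embeds \<rho> (S (\<alpha>, \<beta>)) then g \<alpha> * h \<beta> else 0) =
            g \<alpha> * (\<Sum>\<beta>\<in>H. if \<exists>\<xi>\<in>Y \<alpha>. \<xi> \<preceq> \<beta> then h \<beta> else 0)"
          unfolding sum_distrib_left using emb[OF \<alpha>] by (intro sum.cong) (auto simp: Y_def)
        moreover have "\<forall>\<beta>\<in>Y \<alpha>. is_perm \<beta> \<and> \<beta> \<preceq> \<psi> \<and> has_interval \<beta> \<rho>"
          using W by (auto simp: Y_def)
        ultimately show ?thesis using * fin(2) by (simp add: sum.inter_filter)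
      qed
      then show ?thesis by simp
    qed
    finally show "(\<Sum>t | t \<in> G \<times> H \<and> embeds \<rho> (S t). c t) = 0" .
  qed (use perm fin in auto)
qed

section \<open>Patterns of the two blocks\<close>

text \<open>This reduces containment in a concrete list to a finite computation over its
  subsequences.\<close>

lemma contained_iff_patterns:
  assumes "is_perm \<alpha>" "distinct \<beta>"
  shows "\<alpha> \<preceq> \<beta> \<longleftrightarrow> \<alpha> \<in> set (map standardize (subseqs \<beta>))"
proof
  assume "\<alpha> \<preceq> \<beta>"
  then obtain zs where zs: "subseq zs \<beta>" "order_isomorphic zs \<alpha>" by (auto simp: contained_def)
  have "sim (pts \<alpha>) (pts (standardize zs))"
    by (rule sim_trans[OF sim_sym[OF order_isomorphic_sim[OF zs(2)]]
        order_isomorphic_sim[OF order_isomorphic_standardize]])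
  moreover have "distinct zs" using zs(1) assms(2) subseqs_distinctD by simp
  ultimately have "\<alpha> = standardize zs" using sim_pts_eq assms(1) is_perm_standardize by blast
  then show "\<alpha> \<in> set (map standardize (subseqs \<beta>))" using zs(1) by auto
next
  assume "\<alpha> \<in> set (map standardize (subseqs \<beta>))"
  then show "\<alpha> \<preceq> \<beta>" using order_isomorphic_standardize by (auto simp: contained_def)
qed

lemma contained_iff_mem:
  "is_perm \<alpha> \<Longrightarrow> distinct \<beta> \<and> set (map standardize (subseqs \<beta>)) = A \<Longrightarrow> \<alpha> \<preceq> \<beta> \<longleftrightarrow> \<alpha> \<in> A"
  using contained_iff_patterns by blast

lemma contained_25134: "is_perm \<alpha> \<Longrightarrow> \<alpha> \<preceq> [2,5,1,3,4] \<longleftrightarrow> \<alpha> \<in> {[2,5,1,3,4],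
  [4,1,2,3],[2,1,3,4],[1,4,2,3],[2,4,1,3],[1,2,3],[1,3,2],[2,1,3],[2,3,1],[3,1,2],[1,2],[2,1],[1],[]}"
  by (erule contained_iff_mem) code_simp

lemma contained_23514: "is_perm \<alpha> \<Longrightarrow> \<alpha> \<preceq> [2,3,5,1,4] \<longleftrightarrow> \<alpha> \<in> {[2,3,5,1,4],
  [2,3,4,1],[1,2,4,3],[2,3,1,4],[2,4,1,3],[1,2,3],[1,3,2],[2,1,3],[2,3,1],[3,1,2],[1,2],[2,1],[1],[]}"
  by (erule contained_iff_mem) code_simp

lemma contained_2413: "is_perm \<alpha> \<Longrightarrow> \<alpha> \<preceq> [2,4,1,3] \<longleftrightarrow>
    \<alpha> \<in> {[2,4,1,3],[1,3,2],[2,1,3],[2,3,1],[3,1,2],[1,2],[2,1],[1],[]}"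
  by (erule contained_iff_mem) code_simp

lemma contained_1423: "is_perm \<alpha> \<Longrightarrow> \<alpha> \<preceq> [1,4,2,3] \<longleftrightarrow>
    \<alpha> \<in> {[1,4,2,3],[1,2,3],[1,3,2],[3,1,2],[1,2],[2,1],[1],[]}"
  by (erule contained_iff_mem) code_simp

lemma contained_2314: "is_perm \<alpha> \<Longrightarrow> \<alpha> \<preceq> [2,3,1,4] \<longleftrightarrow>
    \<alpha> \<in> {[2,3,1,4],[1,2,3],[2,1,3],[2,3,1],[1,2],[2,1],[1],[]}"
  by (erule contained_iff_mem) code_simp

lemma contained_312: "is_perm \<alpha> \<Longrightarrow> \<alpha> \<preceq> [3,1,2] \<longleftrightarrow> \<alpha> \<in> {[3,1,2],[1,2],[2,1],[1],[]}"
  by (erule contained_iff_mem) code_simp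

lemma contained_231: "is_perm \<alpha> \<Longrightarrow> \<alpha> \<preceq> [2,3,1] \<longleftrightarrow> \<alpha> \<in> {[2,3,1],[1,2],[2,1],[1],[]}"
  by (erule contained_iff_mem) code_simp

lemma contained_132: "is_perm \<alpha> \<Longrightarrow> \<alpha> \<preceq> [1,3,2] \<longleftrightarrow> \<alpha> \<in> {[1,3,2],[1,2],[2,1],[1],[]}"
  by (erule contained_iff_mem) code_simp

lemma contained_213: "is_perm \<alpha> \<Longrightarrow> \<alpha> \<preceq> [2,1,3] \<longleftrightarrow> \<alpha> \<in> {[2,1,3],[1,2],[2,1],[1],[]}"
  by (erule contained_iff_mem) code_simp

lemma contained_12: "is_perm \<alpha> \<Longrightarrow> \<alpha> \<preceq> [1,2] \<longleftrightarrow> \<alpha> \<in> {[1,2],[1],[]}"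
  by (erule contained_iff_mem) code_simp

lemma contained_21: "is_perm \<alpha> \<Longrightarrow> \<alpha> \<preceq> [2,1] \<longleftrightarrow> \<alpha> \<in> {[2,1],[1],[]}"
  by (erule contained_iff_mem) code_simp

lemma contained_1: "is_perm \<alpha> \<Longrightarrow> \<alpha> \<preceq> [1] \<longleftrightarrow> \<alpha> \<in> {[1],[]}"
  by (erule contained_iff_mem) code_simp

section \<open>Blocks of an inflation as intervals\<close>

lemma has_interval_block:
  assumes \<pi>: "\<pi> = xs @ map (\<lambda>v. v + c) \<alpha> @ ys" and \<alpha>: "is_perm \<alpha>"
    and out: "\<And>v. v \<in> set xs \<union> set ys \<Longrightarrow> v \<le> c \<or> c + length \<alpha> < v"
  shows "has_interval \<alpha> \<pi>"
proof -
  define f where "f p = (fst p + length xs, snd p + c)" for p :: "nat \<times> nat"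
  let ?I = "f ` pts \<alpha>"
  have nth: "\<pi> ! (k + length xs) = \<alpha> ! k + c" if "k < length \<alpha>" for k
    using that by (simp add: \<pi> nth_append)
  have val: "1 \<le> \<alpha> ! k \<and> \<alpha> ! k \<le> length \<alpha>" if "k < length \<alpha>" for k
    using nth_mem[OF that] \<alpha> by (auto simp: is_perm_def)
  have I: "?I = (\<lambda>k. (k + length xs, \<alpha> ! k + c)) ` {..<length \<alpha>}"
    by (simp add: f_def pts_def image_image)
  have "sim_map f (pts \<alpha>) ?I"
    by (auto simp: sim_map_def same_order_def f_def bij_betw_def inj_on_def)
  moreover have "interval ?I (pts \<pi>)"
  proof -
    have sub: "?I \<subseteq> pts \<pi>"
    proof
      fix p assume "p \<in> ?I"
      then obtain k where k: "k < length \<alpha>" "p = (k + length xs, \<alpha> ! k + c)" by (auto simp: I)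
      then have "p = (k + length xs, \<pi> ! (k + length xs))" by (simp add: nth)
      then show "p \<in> pts \<pi>" using k(1) by (auto simp: pts_def \<pi>)
    qed
    have far: "(fst p < length xs \<or> length xs + length \<alpha> \<le> fst p) \<and>
        (snd p \<le> c \<or> c + length \<alpha> < snd p)" if p: "p \<in> pts \<pi>" "p \<notin> ?I" for p
    proof -
      obtain k where k: "k < length \<pi>" "p = (k, \<pi> ! k)" using p(1) by (auto simp: pts_def)
      have "k < length xs \<or> length xs + length \<alpha> \<le> k"
      proof (rule ccontr)
        assume "\<not> ?thesis"
        then have "k - length xs < length \<alpha>" "k = (k - length xs) + length xs" by auto
        then have "p \<in> ?I" using k(2) nth[of "k - length xs"] by (force simp: I)
        then show False using p(2) by simp
      qed
      moreover from this have "\<pi> ! k \<in> set xs \<union> set ys"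
        using k(1) by (auto simp: \<pi> nth_append)
      ultimately show ?thesis using out k(2) by auto
    qed
    have near: "length xs \<le> fst q \<and> fst q < length xs + length \<alpha> \<and> c < snd q \<and> snd q \<le> c + length \<alpha>"
      if "q \<in> ?I" for q using that val by (auto simp: I Suc_le_eq)
    show ?thesis unfolding interval_def
    proof (intro conjI ballI)
      fix p q r assume "p \<in> pts \<pi> - ?I" "q \<in> ?I" "r \<in> ?I"
      then have "(fst p < length xs \<or> length xs + length \<alpha> \<le> fst p) \<and>
          (snd p \<le> c \<or> c + length \<alpha> < snd p)"
        "length xs \<le> fst q \<and> fst q < length xs + length \<alpha> \<and> c < snd q \<and> snd q \<le> c + length \<alpha>"
        "length xs \<le> fst r \<and> fst r < length xs + length \<alpha> \<and> c < snd r \<and> snd r \<le> c + length \<alpha>"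
        using far near by blast+
      then show "same_order p q p r" "same_order q p r p" by (auto simp: same_order_def)
    qed (rule sub)
  qed
  ultimately show ?thesis by (auto simp: has_interval_def sim_def)
qed

text \<open>The inflation is cut into the parts before, in and after block \<open>k\<close>. Blocks
  of smaller entries end at or below the offset of block \<open>k\<close>, and blocks of larger
  entries start above its value range.\<close>

lemma has_interval_inflation:
  assumes \<tau>: "is_perm \<tau>" and perms: "is_perm \<phi>" "is_perm \<psi>" and k: "k < length \<tau>"
  shows "has_interval (inflation_block i j \<phi> \<psi> k) (inflation \<tau> i j \<phi> \<psi>)"
proof -
  let ?b = "inflation_block i j \<phi> \<psi>" and ?o = "inflation_offset \<tau> i j \<phi> \<psi>"
  let ?g = "\<lambda>k. map (\<lambda>v. v + ?o k) (?b k)"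
  have b: "is_perm (?b k)" for k
    using perms by (auto simp: inflation_block_def is_perm_def)
  have out: "v \<le> ?o k \<or> ?o k + length (?b k) < v" if l: "l < length \<tau>" "l \<noteq> k" "v \<in> set (?g l)" for l v
  proof -
    have "?o l < v \<and> v \<le> ?o l + length (?b l)"
      using b[of l] l(3) by (auto simp: is_perm_def)
    moreover have "\<tau> ! l \<noteq> \<tau> ! k" using \<tau> k l by (auto simp: is_perm_def nth_eq_iff_index_eq)
    then have "?o k + length (?b k) \<le> ?o l \<or> ?o l + length (?b l) \<le> ?o k"
      using inflation_offset_less k l by (metis linorder_neqE_nat)
    ultimately show ?thesis by linarith
  qed
  have "[0..<length \<tau>] = [0..<k] @ k # [Suc k..<length \<tau>]"
    using upt_add_eq_append[of 0 k "length \<tau> - k"] upt_conv_Cons[OF k] k by simp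
  then have "inflation \<tau> i j \<phi> \<psi> =
      concat (map ?g [0..<k]) @ ?g k @ concat (map ?g [Suc k..<length \<tau>])"
    by (simp add: inflation_def)
  then show ?thesis
  proof (rule has_interval_block[OF _ b])
    fix v assume "v \<in> set (concat (map ?g [0..<k])) \<union> set (concat (map ?g [Suc k..<length \<tau>]))"
    then have "\<exists>l\<in>set [0..<k] \<union> set [Suc k..<length \<tau>]. v \<in> set (?g l)"
      unfolding set_concat set_map[of ?g] by blast
    then obtain l where l: "l \<in> set [0..<k] \<union> set [Suc k..<length \<tau>]" "v \<in> set (?g l)" ..
    then have "l < length \<tau>" "l \<noteq> k" using k by auto
    then show "v \<le> ?o k \<or> ?o k + length (?b k) < v" using l(2) by (rule out)
  qed
qed

section \<open>Concrete sum cuts and adjacencies\<close>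

lemma pts_zip: "pts xs = set (zip [0..<length xs] xs)"
proof -
  have "set (zip [0..<length xs] xs) = {(k, xs ! k) |k. k < length xs}"
    unfolding set_zip by force
  then show ?thesis by (auto simp: pts_def)
qed

lemma has_interval_sum_cut:
  "is_perm \<rho> \<Longrightarrow> has_interval \<alpha> \<rho> \<Longrightarrow> sum_cut (pts \<alpha>) \<Longrightarrow> mobius [1] \<rho> = 0"
  by (metis has_interval_def mobius_sum_cut sum_cut_transfer)

lemma sum_cutI:
  "interval I P \<and> x \<in> I \<and> (\<forall>y\<in>I. y = x \<or> below y x \<or> below x y) \<and>
    (\<exists>a\<in>I. below a x) \<and> (\<exists>b\<in>I. below x b) \<Longrightarrow> sum_cut P"
  unfolding sum_cut_def by blast

text \<open>2134 is 21 \<oplus> 1 \<oplus> 1 and 1243 is 1 \<oplus> 1 \<oplus> 21, while 4123 and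
  2341 contain 1 \<oplus> 1 \<oplus> 1 as an interval.\<close>

lemma sum_cut_patterns:
  "sum_cut (pts [1,2,3])" "sum_cut (pts [4,1,2,3])" "sum_cut (pts [2,1,3,4])"
  "sum_cut (pts [2,3,4,1])" "sum_cut (pts [1,2,4,3])"
proof -
  show "sum_cut (pts [1,2,3])" unfolding pts_zip
    by (rule sum_cutI[of "{(0,1),(1,2),(2,3)}" _ "(1,2)"]) code_simp
  show "sum_cut (pts [4,1,2,3])" unfolding pts_zip
    by (rule sum_cutI[of "{(1,1),(2,2),(3,3)}" _ "(2,2)"]) code_simp
  show "sum_cut (pts [2,1,3,4])" unfolding pts_zip
    by (rule sum_cutI[of "{(0,2),(1,1),(2,3),(3,4)}" _ "(2,3)"]) code_simp
  show "sum_cut (pts [2,3,4,1])" unfolding pts_zip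
    by (rule sum_cutI[of "{(0,2),(1,3),(2,4)}" _ "(1,3)"]) code_simp
  show "sum_cut (pts [1,2,4,3])" unfolding pts_zip
    by (rule sum_cutI[of "{(0,1),(1,2),(2,4),(3,3)}" _ "(1,2)"]) code_simp
qed

lemma has_interval_12: "has_interval [1,2] [3,1,2]" "has_interval [1,2] [2,3,1]"
proof -
  have "is_perm [1,2]" by (auto simp: is_perm_def)
  then show "has_interval [1,2] [3,1,2]"
    by (intro has_interval_block[of _ "[3]" 0 "[1,2]" "[]"]) auto
  show "has_interval [1,2] [2,3,1]" using \<open>is_perm [1,2]\<close>
    by (intro has_interval_block[of _ "[]" 1 "[1,2]" "[1]"]) auto
qed

lemma has_interval_21: "has_interval [2,1] [1,3,2]" "has_interval [2,1] [2,1,3]"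
proof -
  have "is_perm [2,1]" by (auto simp: is_perm_def)
  then show "has_interval [2,1] [1,3,2]"
    by (intro has_interval_block[of _ "[1]" 1 "[2,1]" "[]"]) auto
  show "has_interval [2,1] [2,1,3]" using \<open>is_perm [2,1]\<close>
    by (intro has_interval_block[of _ "[]" 0 "[2,1]" "[3]"]) auto
qed

text \<open>
  A nonzero coefficient sum for \<open>\<rho>\<close> with \<open>\<mu>[1,\<rho>] \<noteq> 0\<close> forces a member of \<open>A\<close> to occur in
  \<open>\<rho>\<close> as an interval; this is what makes the induction over all pairs in \<open>A \<times> B\<close> close.
\<close>

definition detects :: "nat list set \<Rightarrow> (nat list \<Rightarrow> int) \<Rightarrow> nat list \<Rightarrow> nat list set \<Rightarrow> bool" where
  "detects G g \<phi> A \<longleftrightarrow> finite G \<and> \<phi> \<in> G \<and> g \<phi> \<noteq> 0 \<and>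
     (\<forall>\<alpha>\<in>G. is_perm \<alpha> \<and> \<alpha> \<noteq> [] \<and> \<alpha> \<preceq> \<phi>) \<and>
     (\<forall>\<rho> X. is_perm \<rho> \<longrightarrow> mobius [1] \<rho> \<noteq> 0 \<longrightarrow>
        (\<forall>\<alpha>\<in>X. is_perm \<alpha> \<and> \<alpha> \<preceq> \<phi> \<and> has_interval \<alpha> \<rho>) \<longrightarrow>
        (\<Sum>\<alpha> | \<alpha> \<in> G \<and> (\<exists>\<xi>\<in>X. \<xi> \<preceq> \<alpha>). g \<alpha>) \<noteq> 0 \<longrightarrow> X \<inter> A \<noteq> {})"

text \<open>Were both coefficient sums nonzero for a shorter \<rho>, then \<rho> would have a member
  of \<open>A\<close> and a member of \<open>B\<close> as intervals, and induction would give
  \<mu>[1,\<rho>] = 0. Disjointness is demanded only for nonzero \<mu>, so overlaps may be excluded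
  by showing that they force \<mu> = 0.\<close>

lemma mobius_zero_if_detected:
  assumes A: "\<And>\<phi>. \<phi> \<in> A \<Longrightarrow> \<exists>G g. detects G g \<phi> A"
    and B: "\<And>\<psi>. \<psi> \<in> B \<Longrightarrow> \<exists>H h. detects H h \<psi> B"
    and disj: "\<And>\<rho> I J \<phi> \<psi>. is_perm \<rho> \<Longrightarrow> mobius [1] \<rho> \<noteq> 0 \<Longrightarrow> \<phi> \<in> A \<Longrightarrow> \<psi> \<in> B \<Longrightarrow>
      interval I (pts \<rho>) \<Longrightarrow> interval J (pts \<rho>) \<Longrightarrow> sim (pts \<phi>) I \<Longrightarrow> sim (pts \<psi>) J \<Longrightarrow> I \<inter> J = {}"
  shows "is_perm \<pi> \<Longrightarrow> \<phi> \<in> A \<Longrightarrow> has_interval \<phi> \<pi> \<Longrightarrow> \<psi> \<in> B \<Longrightarrow> has_interval \<psi> \<pi> \<Longrightarrow>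
    mobius [1] \<pi> = 0"
proof (induction "length \<pi>" arbitrary: \<pi> \<phi> \<psi> rule: less_induct)
  case less
  obtain I J where I: "interval I (pts \<pi>)" "sim (pts \<phi>) I"
    and J: "interval J (pts \<pi>)" "sim (pts \<psi>) J"
    using less.prems by (auto simp: has_interval_def)
  obtain G g where G: "detects G g \<phi> A" using A less.prems by blast
  obtain H h where H: "detects H h \<psi> B" using B less.prems by blast
  show ?case
  proof (rule ccontr)
    assume nz: "mobius [1] \<pi> \<noteq> 0"
    have "I \<inter> J = {}" using disj less.prems nz I J by blast
    then have "mobius [1] \<pi> = 0"
    proof (rule mobius_pair_criterion[OF less.prems(1) I(1) J(1) _ _ I(2) _ J(2)])
      fix \<rho> assume \<rho>: "is_perm \<rho>" "length \<rho> < length \<pi>" "mobius [1] \<rho> \<noteq> 0"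
      have False
        if "\<forall>\<alpha>\<in>X. is_perm \<alpha> \<and> \<alpha> \<preceq> \<phi> \<and> has_interval \<alpha> \<rho>"
          "(\<Sum>\<alpha> | \<alpha> \<in> G \<and> (\<exists>\<xi>\<in>X. \<xi> \<preceq> \<alpha>). g \<alpha>) \<noteq> 0"
          "\<forall>\<beta>\<in>Y. is_perm \<beta> \<and> \<beta> \<preceq> \<psi> \<and> has_interval \<beta> \<rho>"
          "(\<Sum>\<beta> | \<beta> \<in> H \<and> (\<exists>\<xi>\<in>Y. \<xi> \<preceq> \<beta>). h \<beta>) \<noteq> 0" for X Y
      proof -
        have "X \<inter> A \<noteq> {}" using G \<rho> that unfolding detects_def by blast
        moreover have "Y \<inter> B \<noteq> {}" using H \<rho> that unfolding detects_def by blast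
        ultimately show False using less.hyps[OF \<rho>(2,1)] \<rho>(3) that by blast
      qed
      then show "(\<forall>X. (\<forall>\<alpha>\<in>X. is_perm \<alpha> \<and> \<alpha> \<preceq> \<phi> \<and> has_interval \<alpha> \<rho>) \<longrightarrow>
            (\<Sum>\<alpha> | \<alpha> \<in> G \<and> (\<exists>\<xi>\<in>X. \<xi> \<preceq> \<alpha>). g \<alpha>) = 0) \<or>
          (\<forall>Y. (\<forall>\<beta>\<in>Y. is_perm \<beta> \<and> \<beta> \<preceq> \<psi> \<and> has_interval \<beta> \<rho>) \<longrightarrow>
            (\<Sum>\<beta> | \<beta> \<in> H \<and> (\<exists>\<xi>\<in>Y. \<xi> \<preceq> \<beta>). h \<beta>) = 0)" by blast
    qed (use G H in \<open>auto simp: detects_def\<close>)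
    then show False using nz by simp
  qed
qed

text \<open>If \<open>X\<close> misses \<open>A\<close>, nonzero \<mu> rules out sum cuts, so all of
  \<open>X\<close> lies below \<gamma>. Then both coefficients are counted and cancel, or
  \<open>X\<close> is empty and none is.\<close>

lemma detects_two:
  assumes "is_perm \<phi>" "is_perm \<gamma>" "\<gamma> \<noteq> []" "\<gamma> \<preceq> \<phi>" "\<gamma> \<noteq> \<phi>"
    and "\<And>\<alpha>. is_perm \<alpha> \<Longrightarrow> \<alpha> \<preceq> \<phi> \<Longrightarrow> \<alpha> \<in> A \<or> sum_cut (pts \<alpha>) \<or> \<alpha> \<preceq> \<gamma>"
  shows "detects {\<phi>, \<gamma>} (\<lambda>\<alpha>. if \<alpha> = \<phi> then 1 else - 1) \<phi> A"
  unfolding detects_def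
proof (intro conjI allI impI)
  show "\<forall>\<alpha>\<in>{\<phi>, \<gamma>}. is_perm \<alpha> \<and> \<alpha> \<noteq> [] \<and> \<alpha> \<preceq> \<phi>"
    using assms(1-4) contained_refl contained_length by fastforce
next
  fix \<rho> X
  assume \<rho>: "is_perm \<rho>" "mobius [1] \<rho> \<noteq> 0"
    and X: "\<forall>\<alpha>\<in>X. is_perm \<alpha> \<and> \<alpha> \<preceq> \<phi> \<and> has_interval \<alpha> \<rho>"
    and sum: "(\<Sum>\<alpha> | \<alpha> \<in> {\<phi>, \<gamma>} \<and> (\<exists>\<xi>\<in>X. \<xi> \<preceq> \<alpha>). if \<alpha> = \<phi> then 1 else - 1) \<noteq> (0::int)"
  show "X \<inter> A \<noteq> {}"
  proof
    assume A: "X \<inter> A = {}"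
    have le: "\<xi> \<preceq> \<gamma>" if "\<xi> \<in> X" for \<xi>
      using assms(6)[of \<xi>] X A that has_interval_sum_cut[OF \<rho>(1), of \<xi>] \<rho>(2) by blast
    have "{\<alpha>. \<alpha> \<in> {\<phi>, \<gamma>} \<and> (\<exists>\<xi>\<in>X. \<xi> \<preceq> \<alpha>)} = (if X = {} then {} else {\<phi>, \<gamma>})"
      using le X by auto
    then show False using sum assms(5) by (simp split: if_splits)
  qed
qed auto

section \<open>Coefficients for the individual blocks\<close>

lemma is_perm_patterns:
  "is_perm [1,2]" "is_perm [2,1]" "is_perm [1]" "is_perm [2,5,1,3,4]" "is_perm [2,3,5,1,4]"
  "is_perm [2,4,1,3]" "is_perm [1,4,2,3]" "is_perm [2,3,1,4]" "is_perm [3,1,2]" "is_perm [2,3,1]"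
  "is_perm [1,3,2]" "is_perm [2,1,3]"
  unfolding is_perm_def by code_simp+

lemma detects_12: "\<exists>G g. detects G g [1,2] {[1,2]}"
proof (intro exI, rule detects_two[of _ "[1]"])
  show "[1] \<preceq> [1,2]" by (simp only: contained_1 contained_12 is_perm_patterns) simp
  fix \<alpha> assume "is_perm \<alpha>" "\<alpha> \<preceq> [1,2]"
  then show "\<alpha> \<in> {[1,2]} \<or> sum_cut (pts \<alpha>) \<or> \<alpha> \<preceq> [1]"
    by (simp only: contained_1 contained_12 insert_iff empty_iff)
      (elim disjE; simp add: sum_cut_patterns del: One_nat_def)
qed (use is_perm_patterns in simp_all)

lemma detects_21: "\<exists>G g. detects G g [2,1] {[2,1]}"
proof (intro exI, rule detects_two[of _ "[1]"])
  show "[1] \<preceq> [2,1]" by (simp only: contained_1 contained_21 is_perm_patterns) simp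
  fix \<alpha> assume "is_perm \<alpha>" "\<alpha> \<preceq> [2,1]"
  then show "\<alpha> \<in> {[2,1]} \<or> sum_cut (pts \<alpha>) \<or> \<alpha> \<preceq> [1]"
    by (simp only: contained_1 contained_21 insert_iff empty_iff)
      (elim disjE; simp add: sum_cut_patterns del: One_nat_def)
qed (use is_perm_patterns in simp_all)

text \<open>Of the proper patterns not below 2413, the patterns 4123, 2134 and 123 have a sum cut.
  Only 1423 is left, which is why it joins the detected set.\<close>

lemma detects_25134: "\<exists>G g. detects G g [2,5,1,3,4] {[2,5,1,3,4], [1,4,2,3]}"
proof (intro exI, rule detects_two[of _ "[2,4,1,3]"])
  show "[2,4,1,3] \<preceq> [2,5,1,3,4]" by (simp only: contained_2413 contained_25134 is_perm_patterns) simp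
  fix \<alpha> assume "is_perm \<alpha>" "\<alpha> \<preceq> [2,5,1,3,4]"
  then show "\<alpha> \<in> {[2,5,1,3,4], [1,4,2,3]} \<or> sum_cut (pts \<alpha>) \<or> \<alpha> \<preceq> [2,4,1,3]"
    by (simp only: contained_2413 contained_25134 insert_iff empty_iff)
      (elim disjE; simp add: sum_cut_patterns del: One_nat_def)
qed (use is_perm_patterns in simp_all)

text \<open>This is the reverse complement of the case 25134; the exceptional pattern 1423 becomes
  2314.\<close>

lemma detects_23514: "\<exists>G g. detects G g [2,3,5,1,4] {[2,3,5,1,4], [2,3,1,4]}"
proof (intro exI, rule detects_two[of _ "[2,4,1,3]"])
  show "[2,4,1,3] \<preceq> [2,3,5,1,4]" by (simp only: contained_2413 contained_23514 is_perm_patterns) simp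
  fix \<alpha> assume "is_perm \<alpha>" "\<alpha> \<preceq> [2,3,5,1,4]"
  then show "\<alpha> \<in> {[2,3,5,1,4], [2,3,1,4]} \<or> sum_cut (pts \<alpha>) \<or> \<alpha> \<preceq> [2,4,1,3]"
    by (simp only: contained_2413 contained_23514 insert_iff empty_iff)
      (elim disjE; simp add: sum_cut_patterns del: One_nat_def)
qed (use is_perm_patterns in simp_all)

text \<open>Since \<open>y\<close> is outside \<open>J\<close>, it cannot separate \<open>x\<close>
  from \<open>z\<close>, and \<open>z\<close>, being outside \<open>I\<close>, cannot separate
  \<open>x\<close> from \<open>y\<close>. So the step from \<open>y\<close> to \<open>x\<close> goes
  in the same direction as the step from \<open>x\<close> to \<open>z\<close>, in both
  coordinates.\<close>

lemma interval_overlap: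
  assumes "interval I P" "interval J P" "x \<in> I \<inter> J" "y \<in> I - J" "z \<in> J - I"
  shows "same_order y x x z" "same_order x y z x"
proof -
  have "same_order y x y z \<and> same_order x y z y"
    using assms(2-5) assms(1) unfolding interval_def by blast
  moreover have "same_order z x z y \<and> same_order x z y z"
    using assms(1-5) unfolding interval_def by blast
  ultimately show "same_order y x x z" "same_order x y z x" by (auto simp: same_order_def)
qed

text \<open>The pair 12, 21 is detected by \<open>12 - 1\<close> and \<open>21 - 1\<close>. Copies
  of the two cannot meet: at a common point an ascent and a descent would have to run in the same
  direction.\<close>

lemma mobius_opposing_adjacencies:
  assumes "is_perm \<pi>" "has_interval [1,2] \<pi>" "has_interval [2,1] \<pi>"
  shows "mobius [1] \<pi> = 0"
proof (rule mobius_zero_if_detected[where A = "{[1,2]}" and B = "{[2,1]}"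
      and \<phi> = "[1,2]" and \<psi> = "[2,1]"])
  fix \<rho> I J \<phi> \<psi>
  assume \<rho>: "is_perm \<rho>" and "\<phi> \<in> {[1::nat,2]}" "\<psi> \<in> {[2::nat,1]}"
    and int: "interval I (pts \<rho>)" "interval J (pts \<rho>)" and "sim (pts \<phi>) I" "sim (pts \<psi>) J"
  then have I: "sim (pts [1,2]) I" and J: "sim (pts [2,1]) J" by auto
  obtain f where f: "sim_map f (pts [1,2]) I" using I by (auto simp: sim_def)
  define a b where "a = f (0, 1)" and "b = f (1, 2)"
  have ab: "I = {a, b}" "below a b"
    using f by (auto simp: a_def b_def sim_map_def pts_zip bij_betw_def same_order_def below_def)
  obtain h where h: "sim_map h (pts [2,1]) J" using J by (auto simp: sim_def)
  define c d where "c = h (0, 2)" and "d = h (1, 1)"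
  have cd: "J = {c, d}" "fst c < fst d" "snd d < snd c"
    using h by (auto simp: c_def d_def sim_map_def pts_zip bij_betw_def same_order_def)
  show "I \<inter> J = {}"
  proof (rule ccontr)
    assume "I \<inter> J \<noteq> {}"
    then obtain x where x: "x \<in> I \<inter> J" by blast
    have "\<exists>y\<in>I. y \<notin> J" "\<exists>z\<in>J. z \<notin> I" using ab cd by (auto simp: below_def)
    then obtain y z where yz: "y \<in> I - J" "z \<in> J - I" by blast
    then have "y \<noteq> x" "z \<noteq> x" using x by auto
    have "same_order y x x z" "same_order x y z x" using interval_overlap[OF int x yz(1,2)] by auto
    with \<open>y \<noteq> x\<close> \<open>z \<noteq> x\<close> show False using ab cd x yz by (auto simp: same_order_def below_def)
  qed
qed (use assms detects_12 detects_21 in simp_all)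

text \<open>
  Intervals \<open>u\<close> and \<open>v\<close> contain opposite adjacencies, so \<open>X\<close> meets at most one of the chains
  \<open>u > 12\<close> and \<open>v > 21\<close>; the coefficients are the Moebius
  function of the interval below \<open>\<phi>\<close> once patterns with a \<open>sum_cut\<close> are left out.
\<close>

lemma detects_fork:
  assumes perms: "is_perm \<phi>" "is_perm u" "is_perm v"
    and len: "length \<phi> = 4" "length u = 3" "length v = 3" "u \<noteq> v"
    and \<phi>: "\<And>\<alpha>. is_perm \<alpha> \<Longrightarrow> \<alpha> \<preceq> \<phi> \<Longrightarrow>
      \<alpha> = \<phi> \<or> sum_cut (pts \<alpha>) \<or> \<alpha> \<in> {u, v, [1,2], [2,1], [1], []}"
    and sub: "u \<preceq> \<phi>" "v \<preceq> \<phi>"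
    and u: "\<And>\<alpha>. is_perm \<alpha> \<Longrightarrow> \<alpha> \<preceq> u \<longleftrightarrow> \<alpha> \<in> {u, [1,2], [2,1], [1], []}"
    and v: "\<And>\<alpha>. is_perm \<alpha> \<Longrightarrow> \<alpha> \<preceq> v \<longleftrightarrow> \<alpha> \<in> {v, [1,2], [2,1], [1], []}"
    and opp: "has_interval [1,2] u" "has_interval [2,1] v"
  shows "detects {\<phi>, u, v, [1,2], [2,1], [1]}
    (\<lambda>\<alpha>. if \<alpha> \<in> {\<phi>, [1,2], [2,1]} then 1 else - 1) \<phi> {\<phi>}"
  (is "detects ?G ?g _ _")
  unfolding detects_def
proof (intro conjI allI impI)
  have "[1,2] \<preceq> u" "[2,1] \<preceq> u" "[1] \<preceq> u" using u is_perm_patterns by auto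
  then show "\<forall>\<alpha>\<in>?G. is_perm \<alpha> \<and> \<alpha> \<noteq> [] \<and> \<alpha> \<preceq> \<phi>"
    using perms len is_perm_patterns sub contained_refl contained_trans[OF _ sub(1)] by auto
next
  fix \<rho> X
  assume \<rho>: "is_perm \<rho>" "mobius [1] \<rho> \<noteq> 0"
    and X: "\<forall>\<alpha>\<in>X. is_perm \<alpha> \<and> \<alpha> \<preceq> \<phi> \<and> has_interval \<alpha> \<rho>"
    and sum: "(\<Sum>\<alpha> | \<alpha> \<in> ?G \<and> (\<exists>\<xi>\<in>X. \<xi> \<preceq> \<alpha>). ?g \<alpha>) \<noteq> (0::int)"
  show "X \<inter> {\<phi>} \<noteq> {}"
  proof
    assume A: "X \<inter> {\<phi>} = {}"
    have sub: "\<xi> \<in> {u, v, [1,2], [2,1], [1], []}" if "\<xi> \<in> X" for \<xi>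
      using \<phi>[of \<xi>] X A that has_interval_sum_cut[OF \<rho>(1), of \<xi>] \<rho>(2) by blast
    \<comment> \<open>Intervals of intervals are intervals, so members of both chains in
      \<open>X\<close> would give \<rho> both adjacencies and hence \<mu> = 0.\<close>
    have "has_interval [1,2] \<rho>" if "u \<in> X \<or> [1,2] \<in> X"
      using that X opp(1) has_interval_trans by blast
    moreover have "has_interval [2,1] \<rho>" if "v \<in> X \<or> [2,1] \<in> X"
      using that X opp(2) has_interval_trans by blast
    ultimately have no: "\<not> ((u \<in> X \<or> [1,2] \<in> X) \<and> (v \<in> X \<or> [2,1] \<in> X))"
      using mobius_opposing_adjacencies[OF \<rho>(1)] \<rho>(2) by blast
    define c where "c \<alpha> \<longleftrightarrow> (\<exists>\<xi>\<in>X. \<xi> \<preceq> \<alpha>)" for \<alpha>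
    have c1: "c [1] \<longleftrightarrow> [1] \<in> X \<or> [] \<in> X"
      unfolding c_def using X contained_1 by blast
    have c12: "c [1,2] \<longleftrightarrow> [1,2] \<in> X \<or> [1] \<in> X \<or> [] \<in> X"
      unfolding c_def using X contained_12 by blast
    have c21: "c [2,1] \<longleftrightarrow> [2,1] \<in> X \<or> [1] \<in> X \<or> [] \<in> X"
      unfolding c_def using X contained_21 by blast
    have cu: "c u \<longleftrightarrow> u \<in> X \<or> [1,2] \<in> X \<or> [2,1] \<in> X \<or> [1] \<in> X \<or> [] \<in> X"
      unfolding c_def using X u by blast
    have cv: "c v \<longleftrightarrow> v \<in> X \<or> [1,2] \<in> X \<or> [2,1] \<in> X \<or> [1] \<in> X \<or> [] \<in> X"
      unfolding c_def using X v by blast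
    have c\<phi>: "c \<phi> \<longleftrightarrow> u \<in> X \<or> v \<in> X \<or> [1,2] \<in> X \<or> [2,1] \<in> X \<or> [1] \<in> X \<or> [] \<in> X"
      unfolding c_def using X sub by blast
    have neq: "\<phi> \<noteq> u" "\<phi> \<noteq> v" "\<phi> \<noteq> [1,2]" "\<phi> \<noteq> [2,1]" "\<phi> \<noteq> [1]" "u \<noteq> v" "u \<noteq> [1,2]" "u \<noteq> [2,1]"
      "u \<noteq> [1]" "v \<noteq> [1,2]" "v \<noteq> [2,1]" "v \<noteq> [1]" using len by auto
    have "(\<Sum>\<alpha> | \<alpha> \<in> ?G \<and> c \<alpha>. ?g \<alpha>) = (\<Sum>\<alpha>\<in>?G. if c \<alpha> then ?g \<alpha> else 0)"
      by (rule sum.inter_filter) simp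
    also have "\<dots> = (if c \<phi> then 1 else 0) - (if c u then 1 else 0) - (if c v then 1 else 0)
        + (if c [1,2] then 1 else 0) + (if c [2,1] then 1 else 0) - (if c [1] then 1 else 0)"
      using neq neq[symmetric] by simp
    \<comment> \<open>If \<open>[1]\<close> or \<open>[]\<close> is in \<open>X\<close>, all six
      terms occur and cancel. Otherwise, by \<open>no\<close>, only one chain is met:
      \<open>u\<close> alone gives 1 - 1, and \<open>[1,2]\<close> gives 1 - 1 - 1 + 1; the other
      chain is alike.\<close>
    also have "\<dots> = 0" unfolding c1 c12 c21 cu cv c\<phi> using no by auto
    finally show False using sum by (simp add: c_def)
  qed
qed simp_all

lemma detects_1423: "detects {[1,4,2,3], [3,1,2], [1,3,2], [1,2], [2,1], [1]}
    (\<lambda>\<alpha>. if \<alpha> \<in> {[1,4,2,3], [1,2], [2,1]} then 1 else - 1) [1,4,2,3] {[1,4,2,3]}"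
proof (rule detects_fork)
  fix \<alpha> assume "is_perm \<alpha>" "\<alpha> \<preceq> [1,4,2,3]"
  then show "\<alpha> = [1,4,2,3] \<or> sum_cut (pts \<alpha>) \<or> \<alpha> \<in> {[3,1,2], [1,3,2], [1,2], [2,1], [1], []}"
    by (simp only: contained_1423 insert_iff empty_iff)
      (elim disjE; simp add: sum_cut_patterns del: One_nat_def)
qed (use is_perm_patterns contained_312 contained_132 contained_1423 has_interval_12 has_interval_21
  in \<open>simp_all del: One_nat_def\<close>)

text \<open>Reverse complement of the case 1423, with 231 and 213 in place of 312 and 132.\<close>

lemma detects_2314: "detects {[2,3,1,4], [2,3,1], [2,1,3], [1,2], [2,1], [1]}
    (\<lambda>\<alpha>. if \<alpha> \<in> {[2,3,1,4], [1,2], [2,1]} then 1 else - 1) [2,3,1,4] {[2,3,1,4]}"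
proof (rule detects_fork)
  fix \<alpha> assume "is_perm \<alpha>" "\<alpha> \<preceq> [2,3,1,4]"
  then show "\<alpha> = [2,3,1,4] \<or> sum_cut (pts \<alpha>) \<or> \<alpha> \<in> {[2,3,1], [2,1,3], [1,2], [2,1], [1], []}"
    by (simp only: contained_2314 insert_iff empty_iff)
      (elim disjE; simp add: sum_cut_patterns del: One_nat_def)
qed (use is_perm_patterns contained_231 contained_213 contained_2314 has_interval_12 has_interval_21
  in \<open>simp_all del: One_nat_def\<close>)

lemma detects_mono: "detects G g \<phi> A \<Longrightarrow> A \<subseteq> B \<Longrightarrow> detects G g \<phi> B"
  unfolding detects_def by blast

section \<open>Overlapping intervals\<close>

text \<open>
  All pairs across the two parts are in the same relative order, so the point set is a
  direct or skew sum of \<open>K\<close> and its complement.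
\<close>

definition splits :: "(nat \<times> nat) set \<Rightarrow> (nat \<times> nat) set \<Rightarrow> bool" where
  "splits P K \<longleftrightarrow> K \<subseteq> P \<and> K \<noteq> {} \<and> K \<noteq> P \<and>
     (\<forall>x\<in>K. \<forall>x'\<in>K. \<forall>y\<in>P - K. \<forall>y'\<in>P - K. same_order x y x' y' \<and> same_order y x y' x')"

lemma splits_image:
  assumes "splits I K" and f: "sim_map f I Q"
  shows "splits Q (f ` K)"
proof -
  have K: "K \<subseteq> I" using assms(1) by (simp add: splits_def)
  have bij: "bij_betw f I Q" using f by (simp add: sim_map_def)
  have diff: "Q - f ` K = f ` (I - K)"
    using bij K inj_on_image_set_diff[of f I I K] by (auto simp: bij_betw_def)
  have so: "same_order p q (f p) (f q)" if "p \<in> I" "q \<in> I" for p q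
    using f that by (simp add: sim_map_def)
  have "same_order (f x) (f y) (f x') (f y') \<and> same_order (f y) (f x) (f y') (f x')"
    if "x \<in> K" "x' \<in> K" "y \<in> I - K" "y' \<in> I - K" for x x' y y'
  proof -
    have "same_order x y x' y' \<and> same_order y x y' x'" using assms(1) that unfolding splits_def by blast
    moreover have "same_order x y (f x) (f y)" "same_order y x (f y) (f x)"
      "same_order x' y' (f x') (f y')" "same_order y' x' (f y') (f x')" using so that K by blast+
    ultimately show ?thesis by (simp add: same_order_def)
  qed
  moreover have "f ` K \<noteq> Q" using diff assms(1) K by (auto simp: splits_def)
  moreover have sub: "f ` K \<subseteq> Q" using bij K by (auto simp: bij_betw_def)
  moreover have "f ` K \<noteq> {}" using assms(1) by (simp add: splits_def)
  ultimately show ?thesis unfolding splits_def diff ball_simps by blast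
qed

text \<open>A point \<open>z\<close> of \<open>J\<close> outside \<open>I\<close> serves as
  reference: each \<open>y\<close> in \<open>I - J\<close> relates to each common \<open>x\<close>
  as \<open>x\<close> does to \<open>z\<close>, and this relation is the same for all
  \<open>x\<close> because \<open>z\<close> does not separate \<open>I\<close>.\<close>

lemma splits_overlap:
  assumes I: "interval I P" and J: "interval J P"
    and ne: "I \<inter> J \<noteq> {}" "\<not> I \<subseteq> J" "\<not> J \<subseteq> I"
  shows "splits I (I \<inter> J)"
proof -
  obtain z where z: "z \<in> J - I" using ne by blast
  have "same_order x y x' y' \<and> same_order y x y' x'"
    if "x \<in> I \<inter> J" "x' \<in> I \<inter> J" "y \<in> I - (I \<inter> J)" "y' \<in> I - (I \<inter> J)" for x x' y y'
  proof -
    have "y \<in> I - J" "y' \<in> I - J" using that by auto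
    then have "same_order y x x z" "same_order x y z x" "same_order y' x x z" "same_order x y' z x"
      "same_order y' x' x' z" "same_order x' y' z x'"
      using interval_overlap[OF I J] that z by blast+
    moreover have "same_order z x z x' \<and> same_order x z x' z"
      using I J that z unfolding interval_def by blast
    ultimately show ?thesis by (auto simp: same_order_def)
  qed
  then show ?thesis using ne unfolding splits_def by blast
qed

text \<open>Only one point of \<open>I\<close> lies outside \<open>J\<close>, and it does not
  separate the interval \<open>J\<close>.\<close>

lemma splits_subinterval:
  assumes "interval I P" "interval J P" "J \<subseteq> I" "card I = Suc (card J)" "J \<noteq> {}" "finite I"
  shows "splits I J"
proof -
  have "card (I - J) = 1" using assms by (simp add: card_Diff_subset finite_subset)
  then obtain y where y: "I - J = {y}" by (auto simp: card_1_singleton_iff)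
  have "same_order y x y x' \<and> same_order x y x' y" if "x \<in> J" "x' \<in> J" for x x'
    using assms(1,2) that y unfolding interval_def by blast
  moreover have "J \<noteq> I" using y by auto
  ultimately show ?thesis using assms(3,5) by (simp add: splits_def y)
qed

text \<open>25134 and 23514 are neither direct nor skew sums, while 1423 and 2314 split only as 1
  \<oplus> 312 and 231 \<oplus> 1. Quantifying over \<open>Pow\<close> makes this a finite
  evaluation.\<close>

lemma splits_patterns:
  "\<forall>K\<in>Pow (pts [2,5,1,3,4]). \<not> splits (pts [2,5,1,3,4]) K"
  "\<forall>K\<in>Pow (pts [2,3,5,1,4]). \<not> splits (pts [2,3,5,1,4]) K"
  "\<forall>K\<in>Pow (pts [1,4,2,3]). splits (pts [1,4,2,3]) K \<longrightarrow> K = {(0,1)} \<or> K = {(1,4),(2,2),(3,3)}"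
  "\<forall>K\<in>Pow (pts [2,3,1,4]). splits (pts [2,3,1,4]) K \<longrightarrow> K = {(3,4)} \<or> K = {(0,2),(1,3),(2,1)}"
  unfolding pts_zip by code_simp+

lemma interval_Un:
  assumes I: "interval I P" and J: "interval J P" and x: "x \<in> I \<inter> J"
  shows "interval (I \<union> J) P"
  unfolding interval_def
proof (intro conjI ballI)
  fix p q r assume pqr: "p \<in> P - (I \<union> J)" "q \<in> I \<union> J" "r \<in> I \<union> J"
  have "same_order p s p x \<and> same_order s p x p" if "s \<in> I \<union> J" for s
    using that pqr(1) x I J unfolding interval_def by blast
  from this[OF pqr(2)] this[OF pqr(3)]
  show "same_order p q p r" "same_order q p r p" by (simp_all add: same_order_def)
qed (use I J in \<open>simp add: interval_def\<close>)

text \<open>In 312 one point is to the left of and above all others; 231 has no such point.\<close>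

lemma not_sim_312_231: "\<not> sim {(1,4),(2,2),(3,3)} {(0,2),(1,3),(2,1)}"
proof
  assume "sim {(1,4),(2,2),(3,3)} {(0,2),(1,3),(2,1)}"
  then obtain f where f: "sim_map f {(1,4),(2,2),(3,3)} {(0,2),(1,3),(2,1)}" by (auto simp: sim_def)
  then have img: "f ` {(1,4),(2,2),(3,3)} = {(0,2),(1,3),(2,1)}"
    by (simp add: sim_map_def bij_betw_def)
  have "fst (f (1,4)) < fst (f (2,2))" "fst (f (1,4)) < fst (f (3,3))"
    "snd (f (2,2)) < snd (f (1,4))" "snd (f (3,3)) < snd (f (1,4))"
    using f by (auto simp: sim_map_def same_order_def)
  then have "\<forall>q\<in>f ` {(1,4),(2,2),(3,3)}. q = f (1,4) \<or> fst (f (1,4)) < fst q \<and> snd q < snd (f (1,4))"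
    by auto
  then have *: "\<forall>q\<in>{(0,2),(1,3),(2,1)}. q = f (1,4) \<or> fst (f (1,4)) < fst q \<and> snd q < snd (f (1,4))"
    unfolding img .
  have "f (1,4) \<in> f ` {(1,4),(2,2),(3,3)}" by blast
  then have "f (1,4) \<in> {(0,2),(1,3),(2,1)}" unfolding img .
  then consider "f (1,4) = (0,2)" | "f (1,4) = (1,3)" | "f (1,4) = (2,1)" by blast
  then show False using * by cases (simp_all only:, simp_all)
qed

text \<open>Equal intervals would have equal patterns. Proper nesting would put an interval of size
  4 into a block of size 5 and split it, which is impossible. A proper overlap splits both blocks,
  so they are 1423 and 2314; they share one point, around which their union is a sum, and \<mu>
  vanishes.\<close>

lemma intervals_disjoint:
  assumes \<rho>: "is_perm \<rho>" "mobius [1] \<rho> \<noteq> 0"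
    and \<phi>: "\<phi> \<in> {[2,5,1,3,4], [1,4,2,3]}" and \<psi>: "\<psi> \<in> {[2,3,5,1,4], [2,3,1,4]}"
    and I: "interval I (pts \<rho>)" and J: "interval J (pts \<rho>)"
    and simI: "sim (pts \<phi>) I" and simJ: "sim (pts \<psi>) J"
  shows "I \<inter> J = {}"
proof (rule ccontr)
  assume ne: "I \<inter> J \<noteq> {}"
  have fin: "finite I" "finite J"
    using I J finite_subset finite_pts unfolding interval_def by blast+
  have card: "card I = length \<phi>" "card J = length \<psi>"
    using sim_card[OF simI] sim_card[OF simJ] by auto
  obtain f where f: "sim_map f I (pts \<phi>)" using sim_sym[OF simI] by (auto simp: sim_def)
  obtain h where h: "sim_map h J (pts \<psi>)" using sim_sym[OF simJ] by (auto simp: sim_def)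
  have Pow: "splits P K \<Longrightarrow> K \<in> Pow P" for P K by (simp add: splits_def)
  have f14: "\<phi> = [1,4,2,3] \<and> (f ` K = {(0,1)} \<or> f ` K = {(1,4),(2,2),(3,3)})" if "splits I K" for K
  proof -
    have *: "splits (pts \<phi>) (f ` K)" by (rule splits_image[OF that f])
    show ?thesis using \<phi> * splits_patterns(1,3) Pow[OF *] by blast
  qed
  have h14: "\<psi> = [2,3,1,4] \<and> (h ` K = {(3,4)} \<or> h ` K = {(0,2),(1,3),(2,1)})" if "splits J K" for K
  proof -
    have *: "splits (pts \<psi>) (h ` K)" by (rule splits_image[OF that h])
    show ?thesis using \<psi> * splits_patterns(2,4) Pow[OF *] by blast
  qed
  consider "I = J" | "J \<subset> I" | "I \<subset> J" | "\<not> I \<subseteq> J" "\<not> J \<subseteq> I" by blast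
  then show False
  proof cases
    case 1
    then have "sim (pts \<phi>) (pts \<psi>)" using sim_trans[OF simI] sim_sym[OF simJ] by simp
    moreover have "is_perm \<phi>" "is_perm \<psi>" using \<phi> \<psi> is_perm_patterns by auto
    ultimately have "\<phi> = \<psi>" by (intro sim_pts_eq)
    moreover have "\<phi> \<noteq> \<psi>" using \<phi> \<psi> by (elim insertE emptyE) simp_all
    ultimately show False by contradiction
  next
    case 2
    then have "card J < card I" using fin(1) by (rule psubset_card_mono[rotated])
    then have "\<phi> = [2,5,1,3,4]" "card I = Suc (card J)" using card \<phi> \<psi> by auto
    moreover have "splits I J" using 2 ne fin(1) calculation(2)
      by (intro splits_subinterval[OF I J]) auto
    ultimately show False using f14 by auto
  next
    case 3
    then have "card I < card J" using fin(2) by (rule psubset_card_mono[rotated])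
    then have "\<psi> = [2,3,5,1,4]" "card J = Suc (card I)" using card \<phi> \<psi> by auto
    moreover have "splits J I" using 3 ne fin(2) calculation(2)
      by (intro splits_subinterval[OF J I]) auto
    ultimately show False using h14 by auto
  next
    case 4
    let ?K = "I \<inter> J"
    have K: "splits I ?K" "splits J ?K"
      using splits_overlap[OF I J ne 4] splits_overlap[OF J I _ 4(2,1)] ne by (simp_all add: Int_commute)
    have simf: "sim ?K (f ` ?K)" and simh: "sim ?K (h ` ?K)"
      using sim_map_subset[OF f, of ?K] sim_map_subset[OF h, of ?K] by (auto simp: sim_def)
    have fh: "sim (f ` ?K) (h ` ?K)" by (rule sim_trans[OF sim_sym[OF simf] simh])
    then have "card (f ` ?K) = card (h ` ?K)" by (rule sim_card)
    \<comment> \<open>Equal cardinality pairs single point with single point or triple with triple;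
      the triples are 312 and 231, which are not similar.\<close>
    then have "f ` ?K = {(0,1)} \<and> h ` ?K = {(3,4)} \<or>
        f ` ?K = {(1,4),(2,2),(3,3)} \<and> h ` ?K = {(0,2),(1,3),(2,1)}"
      using f14[OF K(1)] h14[OF K(2)] by (elim conjE disjE) simp_all
    then have fK: "f ` ?K = {(0,1)}" and hK: "h ` ?K = {(3,4)}"
      using fh not_sim_312_231 by auto
    txt \<open>Here \<open>I \<union> J\<close> is an interval \<open>231 \<oplus> 1 \<oplus> 312\<close>.\<close>
    obtain x where x: "x \<in> ?K" using ne by blast
    have fx: "f x = (0,1)" and hx: "h x = (3,4)" using fK hK x by blast+
    have up: "below x y" if "y \<in> I" "y \<noteq> x" for y
    proof -
      have "f y \<in> pts [1,4,2,3]" "f y \<noteq> f x" "same_order x y (f x) (f y)"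
        using f f14[OF K(1)] that x by (auto simp: sim_map_def bij_betw_def inj_on_def)
      then show ?thesis by (auto simp: fx pts_zip same_order_def below_def)
    qed
    have down: "below y x" if "y \<in> J" "y \<noteq> x" for y
    proof -
      have "h y \<in> pts [2,3,1,4]" "h y \<noteq> h x" "same_order y x (h y) (h x)"
        using h h14[OF K(2)] that x by (auto simp: sim_map_def bij_betw_def inj_on_def)
      then show ?thesis by (auto simp: hx pts_zip same_order_def below_def)
    qed
    obtain a b where "a \<in> J - I" "b \<in> I - J" using 4 by blast
    then have "a \<in> J" "below a x" "b \<in> I" "below x b" using x up[of b] down[of a] by auto
    then have "sum_cut (pts \<rho>)" unfolding sum_cut_def
      using interval_Un[OF I J x] x up down by (intro exI[of _ "I \<union> J"] exI[of _ x]) auto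
    then show False using mobius_sum_cut \<rho> by blast
  qed
qed

theorem theorem6p4: "annihilator_pair [2, 5, 1, 3, 4] [2, 3, 5, 1, 4]"
proof -
  let ?A = "{[2,5,1,3,4], [1,4,2,3]}" and ?B = "{[2,3,5,1,4], [2,3,1,4]}"
  have "mobius [1] (inflation \<tau> i j [2,5,1,3,4] [2,3,5,1,4]) = 0"
    if \<tau>: "is_perm \<tau>" and ij: "i < length \<tau>" "j < length \<tau>" "i \<noteq> j" for \<tau> i j
  proof (rule mobius_zero_if_detected[where A = ?A and B = ?B
        and \<phi> = "[2,5,1,3,4]" and \<psi> = "[2,3,5,1,4]"])
    show "\<exists>G g. detects G g \<phi> ?A" if "\<phi> \<in> ?A" for \<phi>
      using that detects_25134 detects_mono[OF detects_1423] by blast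
    show "\<exists>H h. detects H h \<psi> ?B" if "\<psi> \<in> ?B" for \<psi>
      using that detects_23514 detects_mono[OF detects_2314] by blast
    show "has_interval [2,5,1,3,4] (inflation \<tau> i j [2,5,1,3,4] [2,3,5,1,4])"
      using has_interval_inflation[OF \<tau> is_perm_patterns(4,5) ij(1), of i j]
      by (simp add: inflation_block_def)
    \<comment> \<open>\<open>inflation_block\<close> tests for position \<open>i\<close> first, so
      \<open>i \<noteq> j\<close> is what makes block \<open>j\<close> the second one.\<close>
    show "has_interval [2,3,5,1,4] (inflation \<tau> i j [2,5,1,3,4] [2,3,5,1,4])"
      using has_interval_inflation[OF \<tau> is_perm_patterns(4,5) ij(2), of i j] ij(3)
      by (simp add: inflation_block_def)
    show "is_perm (inflation \<tau> i j [2,5,1,3,4] [2,3,5,1,4])"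
      by (rule is_perm_inflation[OF \<tau> is_perm_patterns(4,5)])
  qed (use intervals_disjoint in blast, simp_all)
  then show ?thesis using is_perm_patterns(4,5) by (simp add: annihilator_pair_def)
qed

end
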